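(* Let $\mathbb X$ be a developable complex of groups over a connected scwol $X$ and let $\sigma_0\in VX$. Then the scwol $\tilde X_{\sigma_0}$ (the universal complex of $\mathbb X$ with respect to $\sigma_0$) is simply connected, i.e. connected with trivial fundamental group.
   Context: Scwols. A scwol $X$ consists of sets $VX$ (vertices), $EX$ (edges), maps $i,t:EX\to VX$ and a composition $E^2X:=\{(a,b)\in EX\times EX: i(a)=t(b)\}\to EX$, $(a,b)\mapsto ab$, with $i(ab)=i(b)$, $t(ab)=t(a)$; $(ab)c=a(bc)$ whenever $i(a)=t(b)$, $i(b)=t(c)$; and $i(a)\neq t(a)$ for all $a\in EX$. $E^3X$ is the set of triples of edges $(a,b,c)$ with $i(a)=t(b)$, $i(b)=t(c)$. Complexes of groups. A complex of groups $\mathbb X$ over $X$ is a tuple $((G_\sigma)_{\sigma\in VX},(\psi_a)_{a\in EX},(g_{a,b})_{(a,b)\in E^2X})$ with groups $G_\sigma$, injective homomorphisms $\psi_a:G_{i(a)}\to G_{t(a)}$ and elements $g_{a,b}\in G_{t(a)}$ such that $c_{g_{a,b}}\circ\psi_{ab}=\psi_a\circ\psi_b$ on $E^2X$ and $\psi_a(g_{b,c})g_{a,bc}=g_{a,b}g_{ab,c}$ on $E^3X$, where $c_h(g)=hgh^{-1}$. Paths. Oriented edges are the $a\in EX$ and formal inverses $a^{-1}$, with $i(a^{-1})=t(a)$, $t(a^{-1})=i(a)$, $(a^{-1})^{-1}=a$. A path in $X$ is a finite sequence of oriented edges $(e_1,\dots,e_k)$ with $t(e_j)=i(e_{j+1})$;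 $X$ is connected if any two vertices are joined by a finite path. An $\mathbb X$-path is a tuple $p=(g_0,e_1,g_1,\dots,e_k,g_k)$ with $(e_1,\dots,e_k)$ a path, $g_0\in G_{i(e_1)}$, $g_j\in G_{t(e_j)}$; $i(p)=i(e_1)$, $t(p)=t(e_k)$ (for length $0$: $p=(g)$ with $g\in G_\sigma$, at a vertex $\sigma$). Concatenation $p\star q$ (when $t(p)=i(q)$) multiplies the last group element of $p$ with the first of $q$. $\mathcal P_{\sigma_0}(\mathbb X)$ denotes the set of $\mathbb X$-paths starting at $\sigma_0$. Homotopy $\sim$ of $\mathbb X$-paths is the equivalence relation generated by the following replacements of subpaths: $(kg,a,h)\to(k,a,\psi_a(g)h)$; $(g,a^{-1},hk)\to(g\psi_a(h),a^{-1},k)$; $(g,a,\psi_a(h),a^{-1},k)\to(ghk)$; $(g,b^{-1},h,b,k)\to(g\psi_b(h)k)$; $(g,b,1,a,k)\to(g,ab,g_{a,b}^{-1}k)$ and $(g,a^{-1},1,b^{-1},k)\to(gg_{a,b},(ab)^{-1},k)$ for $(a,b)\in E^2X$. $[p]$ is the homotopy class. $\pi_1(\mathbb X,\sigma_0)$ is the group of homotopy classes of $\mathbb X$-paths from $\sigma_0$ to $\sigma_0$ with $[p][q]=[p\star q]$. The fundamental group of a scwol is the fundamental group of the trivial complex of groups over it (all local groups trivial). $\mathbb X$ is developable if it arises (up to isomorphism) from an action of a group on a scwol; equivalently (and this may be taken as the definition), for every $\sigma\in VX$ the homomorphism $G_\sigma\to\pi_1(\mathbb X,\sigma)$, $g\mapsto[(g)]$,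 is injective. Universal complex. For $p,q\in\mathcal P_{\sigma_0}(\mathbb X)$ put $p\equiv q$ iff $[q]=[p\star(g)]$ for some $g\in G_{t(p)}$; $[\![p]\!]$ is the $\equiv$-class. The scwol $\tilde X_{\sigma_0}$ has vertices $[\![p]\!]$, $p\in\mathcal P_{\sigma_0}(\mathbb X)$, edges the triples $([\![p]\!],a,[\![p\star(1,a,1)]\!])$ with $a\in EX$, $i(a)=t(p)$; $i,t$ are the first and third projections, and the composite of $([\![p\star(1,b,1)]\!],a,\cdot)$ with $([\![p]\!],b,\cdot)$ is $([\![p]\!],ab,[\![p\star(1,ab,1)]\!])$. *)

theory Defs
  imports "HOL-Algebra.Elementary_Groups"
begin

section \<open>Scwols\<close>

record ('v, 'e) scwol_data =
  verts :: "'v set"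
  edges :: "'e set"
  ini :: "'e \<Rightarrow> 'v"
  ter :: "'e \<Rightarrow> 'v"
  cmp :: "'e \<Rightarrow> 'e \<Rightarrow> 'e"  \<comment> \<open>\<open>cmp X a b\<close> is \<open>ab\<close>, relevant only if \<open>ini X a = ter X b\<close>\<close>

definition edges2 :: "('v, 'e) scwol_data \<Rightarrow> ('e \<times> 'e) set" where
  "edges2 X = {(a, b). a \<in> edges X \<and> b \<in> edges X \<and> ini X a = ter X b}"

definition edges3 :: "('v, 'e) scwol_data \<Rightarrow> ('e \<times> 'e \<times> 'e) set" where
  "edges3 X = {(a, b, c). (a, b) \<in> edges2 X \<and> (b, c) \<in> edges2 X}"

locale scwol =
  fixes X :: "('v, 'e) scwol_data"
  assumes ini_in: "a \<in> edges X \<Longrightarrow> ini X a \<in> verts X"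
    and ter_in: "a \<in> edges X \<Longrightarrow> ter X a \<in> verts X"
    and cmp_in: "(a, b) \<in> edges2 X \<Longrightarrow> cmp X a b \<in> edges X"
    and ini_cmp: "(a, b) \<in> edges2 X \<Longrightarrow> ini X (cmp X a b) = ini X b"
    and ter_cmp: "(a, b) \<in> edges2 X \<Longrightarrow> ter X (cmp X a b) = ter X a"
    and cmp_assoc: "(a, b, c) \<in> edges3 X \<Longrightarrow> cmp X (cmp X a b) c = cmp X a (cmp X b c)"
    and no_loop: "a \<in> edges X \<Longrightarrow> ini X a \<noteq> ter X a"

text \<open>Oriented edges: \<open>Fwd a\<close> is the edge \<open>a\<close> itself, \<open>Bwd a\<close> its formal inverse.\<close>

datatype 'e oedge = Fwd 'e | Bwd 'e

fun oedge_of :: "'e oedge \<Rightarrow> 'e" where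
  "oedge_of (Fwd a) = a"
| "oedge_of (Bwd a) = a"

fun oini :: "('v, 'e) scwol_data \<Rightarrow> 'e oedge \<Rightarrow> 'v" where
  "oini X (Fwd a) = ini X a"
| "oini X (Bwd a) = ter X a"

fun oter :: "('v, 'e) scwol_data \<Rightarrow> 'e oedge \<Rightarrow> 'v" where
  "oter X (Fwd a) = ter X a"
| "oter X (Bwd a) = ini X a"

text \<open>\<open>is_path X \<sigma> es \<tau>\<close>: the sequence \<open>es\<close> is a path in \<open>X\<close> from \<open>\<sigma>\<close> to \<open>\<tau>\<close>.\<close>

fun is_path :: "('v, 'e) scwol_data \<Rightarrow> 'v \<Rightarrow> 'e oedge list \<Rightarrow> 'v \<Rightarrow> bool" where
  "is_path X \<sigma> [] \<tau> \<longleftrightarrow> \<sigma> \<in> verts X \<and> \<sigma> = \<tau>"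
| "is_path X \<sigma> (e # es) \<tau> \<longleftrightarrow>
     oedge_of e \<in> edges X \<and> oini X e = \<sigma> \<and> is_path X (oter X e) es \<tau>"

definition connected_scwol :: "('v, 'e) scwol_data \<Rightarrow> bool" where
  "connected_scwol X \<longleftrightarrow> (\<forall>\<sigma>\<in>verts X. \<forall>\<tau>\<in>verts X. \<exists>es. is_path X \<sigma> es \<tau>)"

section \<open>Complexes of groups\<close>

record ('v, 'e, 'g) cog_data =
  base :: "('v, 'e) scwol_data"
  grp :: "'v \<Rightarrow> 'g monoid"
  psi :: "'e \<Rightarrow> 'g \<Rightarrow> 'g"
  twist :: "'e \<Rightarrow> 'e \<Rightarrow> 'g"

locale complex_of_groups =
  fixes K :: "('v, 'e, 'g) cog_data"
  assumes scwol_base: "scwol (base K)"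
    and group_grp: "\<sigma> \<in> verts (base K) \<Longrightarrow> group (grp K \<sigma>)"
    and psi_hom: "a \<in> edges (base K) \<Longrightarrow>
      psi K a \<in> hom (grp K (ini (base K) a)) (grp K (ter (base K) a))"
    and psi_inj: "a \<in> edges (base K) \<Longrightarrow> inj_on (psi K a) (carrier (grp K (ini (base K) a)))"
    and twist_in: "(a, b) \<in> edges2 (base K) \<Longrightarrow>
      twist K a b \<in> carrier (grp K (ter (base K) a))"
    and twist_conj: "\<lbrakk>(a, b) \<in> edges2 (base K); x \<in> carrier (grp K (ini (base K) b))\<rbrakk> \<Longrightarrow>
      twist K a b \<otimes>\<^bsub>grp K (ter (base K) a)\<^esub> psi K (cmp (base K) a b) x
        \<otimes>\<^bsub>grp K (ter (base K) a)\<^esub> (inv\<^bsub>grp K (ter (base K) a)\<^esub> twist K a b)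
      = psi K a (psi K b x)"
    and twist_cocycle: "(a, b, c) \<in> edges3 (base K) \<Longrightarrow>
      psi K a (twist K b c) \<otimes>\<^bsub>grp K (ter (base K) a)\<^esub> twist K a (cmp (base K) b c)
      = twist K a b \<otimes>\<^bsub>grp K (ter (base K) a)\<^esub> twist K (cmp (base K) a b) c"

text \<open>
  The path \<open>(g\<^sub>0, e\<^sub>1, g\<^sub>1, \<dots>, e\<^sub>k, g\<^sub>k)\<close> starting at \<open>\<sigma>\<close> is encoded as
  \<open>(\<sigma>, g\<^sub>0, [(e\<^sub>1, g\<^sub>1), \<dots>, (e\<^sub>k, g\<^sub>k)])\<close>.  The initial vertex is recorded because
  all local groups live on one type, so \<open>(g)\<close> alone would not determine its vertex.
\<close>

type_synonym ('v, 'e, 'g) gpath = "'v \<times> 'g \<times> ('e oedge \<times> 'g) list"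

definition gsrc :: "('v, 'e, 'g) gpath \<Rightarrow> 'v" where
  "gsrc p = fst p"

fun gtgt :: "('v, 'e, 'g) cog_data \<Rightarrow> ('v, 'e, 'g) gpath \<Rightarrow> 'v" where
  "gtgt K (\<sigma>, g, xs) = (if xs = [] then \<sigma> else oter (base K) (fst (last xs)))"

definition gpaths :: "('v, 'e, 'g) cog_data \<Rightarrow> ('v, 'e, 'g) gpath set" where
  "gpaths K = {(\<sigma>, g, xs).
     (\<exists>\<tau>. is_path (base K) \<sigma> (map fst xs) \<tau>) \<and> g \<in> carrier (grp K \<sigma>) \<and>
     (\<forall>(e, h) \<in> set xs. h \<in> carrier (grp K (oter (base K) e)))}"

definition gpaths_from :: "('v, 'e, 'g) cog_data \<Rightarrow> 'v \<Rightarrow> ('v, 'e, 'g) gpath set" where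
  "gpaths_from K \<sigma> = {p \<in> gpaths K. gsrc p = \<sigma>}"

text \<open>Concatenation, meaningful if \<open>gtgt K p = gsrc q\<close>.\<close>

fun gconc :: "('v, 'e, 'g) cog_data \<Rightarrow> ('v, 'e, 'g) gpath \<Rightarrow> ('v, 'e, 'g) gpath
    \<Rightarrow> ('v, 'e, 'g) gpath" where
  "gconc K (\<sigma>, g, []) (\<tau>, h, ys) = (\<sigma>, g \<otimes>\<^bsub>grp K \<sigma>\<^esub> h, ys)"
| "gconc K (\<sigma>, g, (e, k) # xs) q =
     (case gconc K (oter (base K) e, k, xs) q of (_, k', zs) \<Rightarrow> (\<sigma>, g, (e, k') # zs))"

inductive gmove :: "('v, 'e, 'g) cog_data \<Rightarrow> ('v, 'e, 'g) gpath \<Rightarrow> ('v, 'e, 'g) gpath \<Rightarrow> bool"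
  for K where
  slide_fwd: "\<lbrakk>a \<in> edges (base K); \<sigma> = ini (base K) a; \<tau> = ter (base K) a;
      k \<in> carrier (grp K \<sigma>); g \<in> carrier (grp K \<sigma>); h \<in> carrier (grp K \<tau>)\<rbrakk> \<Longrightarrow>
    gmove K (\<sigma>, k \<otimes>\<^bsub>grp K \<sigma>\<^esub> g, [(Fwd a, h)])
            (\<sigma>, k, [(Fwd a, psi K a g \<otimes>\<^bsub>grp K \<tau>\<^esub> h)])"
| slide_bwd: "\<lbrakk>a \<in> edges (base K); \<sigma> = ini (base K) a; \<tau> = ter (base K) a;
      g \<in> carrier (grp K \<tau>); h \<in> carrier (grp K \<sigma>); k \<in> carrier (grp K \<sigma>)\<rbrakk> \<Longrightarrow>
    gmove K (\<tau>, g, [(Bwd a, h \<otimes>\<^bsub>grp K \<sigma>\<^esub> k)])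
            (\<tau>, g \<otimes>\<^bsub>grp K \<tau>\<^esub> psi K a h, [(Bwd a, k)])"
| cancel_fwd: "\<lbrakk>a \<in> edges (base K); \<sigma> = ini (base K) a;
      g \<in> carrier (grp K \<sigma>); h \<in> carrier (grp K \<sigma>); k \<in> carrier (grp K \<sigma>)\<rbrakk> \<Longrightarrow>
    gmove K (\<sigma>, g, [(Fwd a, psi K a h), (Bwd a, k)])
            (\<sigma>, g \<otimes>\<^bsub>grp K \<sigma>\<^esub> h \<otimes>\<^bsub>grp K \<sigma>\<^esub> k, [])"
| cancel_bwd: "\<lbrakk>b \<in> edges (base K); \<sigma> = ini (base K) b; \<tau> = ter (base K) b;
      g \<in> carrier (grp K \<tau>); h \<in> carrier (grp K \<sigma>); k \<in> carrier (grp K \<tau>)\<rbrakk> \<Longrightarrow>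
    gmove K (\<tau>, g, [(Bwd b, h), (Fwd b, k)])
            (\<tau>, g \<otimes>\<^bsub>grp K \<tau>\<^esub> psi K b h \<otimes>\<^bsub>grp K \<tau>\<^esub> k, [])"
| comp_fwd: "\<lbrakk>(a, b) \<in> edges2 (base K); \<sigma> = ini (base K) b; \<rho> = ter (base K) a;
      g \<in> carrier (grp K \<sigma>); k \<in> carrier (grp K \<rho>)\<rbrakk> \<Longrightarrow>
    gmove K (\<sigma>, g, [(Fwd b, \<one>\<^bsub>grp K (ter (base K) b)\<^esub>), (Fwd a, k)])
            (\<sigma>, g, [(Fwd (cmp (base K) a b), (inv\<^bsub>grp K \<rho>\<^esub> twist K a b) \<otimes>\<^bsub>grp K \<rho>\<^esub> k)])"
| comp_bwd: "\<lbrakk>(a, b) \<in> edges2 (base K); \<sigma> = ini (base K) b; \<rho> = ter (base K) a;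
      g \<in> carrier (grp K \<rho>); k \<in> carrier (grp K \<sigma>)\<rbrakk> \<Longrightarrow>
    gmove K (\<rho>, g, [(Bwd a, \<one>\<^bsub>grp K (ini (base K) a)\<^esub>), (Bwd b, k)])
            (\<rho>, g \<otimes>\<^bsub>grp K \<rho>\<^esub> twist K a b, [(Bwd (cmp (base K) a b), k)])"

text \<open>
  Replacement of a subpath \<open>s\<close> of \<open>u \<star> s \<star> v\<close>.  Replacing consecutive entries is the same
  thing, since \<open>u\<close> and \<open>v\<close> may end resp. start with the neutral element.
\<close>

inductive gstep :: "('v, 'e, 'g) cog_data \<Rightarrow> ('v, 'e, 'g) gpath \<Rightarrow> ('v, 'e, 'g) gpath \<Rightarrow> bool"
  for K where
  "\<lbrakk>gmove K s s'; u \<in> gpaths K; v \<in> gpaths K; gtgt K u = gsrc s; gtgt K s = gsrc v\<rbrakk> \<Longrightarrow>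
    gstep K (gconc K (gconc K u s) v) (gconc K (gconc K u s') v)"

definition homotopic :: "('v, 'e, 'g) cog_data \<Rightarrow> ('v, 'e, 'g) gpath \<Rightarrow> ('v, 'e, 'g) gpath \<Rightarrow> bool"
  where "homotopic K = equivclp (gstep K)"

definition hclass :: "('v, 'e, 'g) cog_data \<Rightarrow> ('v, 'e, 'g) gpath \<Rightarrow> ('v, 'e, 'g) gpath set" where
  "hclass K p = {q \<in> gpaths K. homotopic K p q}"

definition cog_pi1 :: "('v, 'e, 'g) cog_data \<Rightarrow> 'v \<Rightarrow> ('v, 'e, 'g) gpath set monoid" where
  "cog_pi1 K \<sigma> = \<lparr>
     carrier = hclass K ` {p \<in> gpaths_from K \<sigma>. gtgt K p = \<sigma>},
     monoid.mult = (\<lambda>P Q. \<Union>p\<in>P. \<Union>q\<in>Q. hclass K (gconc K p q)),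
     one = hclass K (\<sigma>, \<one>\<^bsub>grp K \<sigma>\<^esub>, [])\<rparr>"

definition developable :: "('v, 'e, 'g) cog_data \<Rightarrow> bool" where
  "developable K \<longleftrightarrow>
     (\<forall>\<sigma>\<in>verts (base K). inj_on (\<lambda>g. hclass K (\<sigma>, g, [])) (carrier (grp K \<sigma>)))"

section \<open>Simply connected scwols\<close>

definition trivial_cog :: "('v, 'e) scwol_data \<Rightarrow> ('v, 'e, unit) cog_data" where
  "trivial_cog X = \<lparr>base = X, grp = (\<lambda>_. singleton_group ()), psi = (\<lambda>_ _. ()), twist = (\<lambda>_ _. ())\<rparr>"

definition scwol_pi1 :: "('v, 'e) scwol_data \<Rightarrow> 'v \<Rightarrow> ('v, 'e, unit) gpath set monoid" where
  "scwol_pi1 X = cog_pi1 (trivial_cog X)"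

definition simply_connected_scwol :: "('v, 'e) scwol_data \<Rightarrow> bool" where
  "simply_connected_scwol X \<longleftrightarrow>
     connected_scwol X \<and> (\<forall>\<sigma>\<in>verts X. trivial_group (scwol_pi1 X \<sigma>))"

section \<open>The universal complex\<close>

definition end_equiv :: "('v, 'e, 'g) cog_data \<Rightarrow> ('v, 'e, 'g) gpath \<Rightarrow> ('v, 'e, 'g) gpath \<Rightarrow> bool"
  where "end_equiv K p q \<longleftrightarrow>
    (\<exists>g\<in>carrier (grp K (gtgt K p)). hclass K q = hclass K (gconc K p (gtgt K p, g, [])))"

definition eclass :: "('v, 'e, 'g) cog_data \<Rightarrow> 'v \<Rightarrow> ('v, 'e, 'g) gpath \<Rightarrow> ('v, 'e, 'g) gpath set"
  where "eclass K \<sigma>\<^sub>0 p = {q \<in> gpaths_from K \<sigma>\<^sub>0. end_equiv K p q}"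

text \<open>The extension \<open>p \<star> (1, a, 1)\<close>.\<close>

definition gsnoc :: "('v, 'e, 'g) cog_data \<Rightarrow> ('v, 'e, 'g) gpath \<Rightarrow> 'e \<Rightarrow> ('v, 'e, 'g) gpath" where
  "gsnoc K p a = gconc K p
     (ini (base K) a, \<one>\<^bsub>grp K (ini (base K) a)\<^esub>, [(Fwd a, \<one>\<^bsub>grp K (ter (base K) a)\<^esub>)])"

text \<open>
  In the composition, the union over \<open>p \<in> P\<close> is the usual way of evaluating a
  class-valued expression on an equivalence class.
\<close>

definition universal_complex :: "('v, 'e, 'g) cog_data \<Rightarrow> 'v \<Rightarrow>
    (('v, 'e, 'g) gpath set, ('v, 'e, 'g) gpath set \<times> 'e \<times> ('v, 'e, 'g) gpath set) scwol_data"
  where "universal_complex K \<sigma>\<^sub>0 = \<lparr>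
    verts = eclass K \<sigma>\<^sub>0 ` gpaths_from K \<sigma>\<^sub>0,
    edges = {(eclass K \<sigma>\<^sub>0 p, a, eclass K \<sigma>\<^sub>0 (gsnoc K p a)) | p a.
      p \<in> gpaths_from K \<sigma>\<^sub>0 \<and> a \<in> edges (base K) \<and> ini (base K) a = gtgt K p},
    ini = (\<lambda>(P, a, Q). P),
    ter = (\<lambda>(P, a, Q). Q),
    cmp = (\<lambda>(Q, a, R) (P, b, Q').
      (P, cmp (base K) a b, \<Union>p\<in>P. eclass K \<sigma>\<^sub>0 (gsnoc K p (cmp (base K) a b))))\<rparr>"

end

theory Submission
  imports Defs
begin

text \<open>
  A path in the complex of groups lifts to a path of oriented edges in the universal complex, running
  through the classes of its initial segments.  Each elementary homotopy move either leaves the lift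
  unchanged or becomes a cancellation or composition move of the scwol upstairs, so homotopic paths
  have homotopic lifts; and every edge path starting at \<open>\<lbrakk>p\<rbrakk>\<close> is the lift of some \<open>q\<close>.  If this
  edge path is a loop, then \<open>p \<star> q\<close> is homotopic to \<open>p \<star> (g)\<close>, whose lift equals that of \<open>p\<close>.  So
  appending the loop to the lift of \<open>p\<close> does not change the homotopy class, and cancelling the lift
  of \<open>p\<close> shows that the loop is null-homotopic.
\<close>

section \<open>Paths and homotopy\<close>

definition gpaths_betw :: "('v, 'e, 'g) cog_data \<Rightarrow> 'v \<Rightarrow> 'v \<Rightarrow> ('v, 'e, 'g) gpath set" where
  "gpaths_betw K \<sigma> \<tau> = {p \<in> gpaths K. gsrc p = \<sigma> \<and> gtgt K p = \<tau>}"

lemma gsrc_simp [simp]: "gsrc (\<sigma>, g, xs) = \<sigma>"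
  by (simp add: gsrc_def)

lemma gtgt_Nil [simp]: "gtgt K (\<sigma>, g, []) = \<sigma>"
  by simp

lemma gtgt_Cons [simp]: "gtgt K (\<sigma>, g, (e, h) # xs) = gtgt K (oter (base K) e, h, xs)"
  by simp

declare gtgt.simps [simp del]

lemma gpaths_betw_Nil [simp]:
  "(\<sigma>', g, []) \<in> gpaths_betw K \<sigma> \<tau> \<longleftrightarrow>
    \<sigma>' = \<sigma> \<and> \<tau> = \<sigma> \<and> \<sigma> \<in> verts (base K) \<and> g \<in> carrier (grp K \<sigma>)"
  by (auto simp: gpaths_betw_def gpaths_def)

lemma gpaths_betw_Cons [simp]:
  "(\<sigma>', g, (e, h) # xs) \<in> gpaths_betw K \<sigma> \<tau> \<longleftrightarrow>
    \<sigma>' = \<sigma> \<and> oedge_of e \<in> edges (base K) \<and> oini (base K) e = \<sigma> \<and> g \<in> carrier (grp K \<sigma>) \<and>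
    (oter (base K) e, h, xs) \<in> gpaths_betw K (oter (base K) e) \<tau>"
  by (auto simp: gpaths_betw_def gpaths_def)

lemma gpaths_betwD:
  "p \<in> gpaths_betw K \<sigma> \<tau> \<Longrightarrow> p \<in> gpaths K"
  "p \<in> gpaths_betw K \<sigma> \<tau> \<Longrightarrow> gsrc p = \<sigma>"
  "p \<in> gpaths_betw K \<sigma> \<tau> \<Longrightarrow> gtgt K p = \<tau>"
  by (simp_all add: gpaths_betw_def)

lemma gpaths_from_iff: "p \<in> gpaths_from K \<sigma> \<longleftrightarrow> p \<in> gpaths_betw K \<sigma> (gtgt K p)"
  by (auto simp: gpaths_betw_def gpaths_from_def)

lemma homotopic_refl [simp, intro]: "homotopic K p p"
  by (simp add: homotopic_def)

lemma homotopic_sym: "homotopic K p q \<Longrightarrow> homotopic K q p"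
  by (simp add: homotopic_def equivclp_sym)

lemma homotopic_trans [trans]: "homotopic K p q \<Longrightarrow> homotopic K q r \<Longrightarrow> homotopic K p r"
  unfolding homotopic_def by (rule equivclp_trans)

lemma hclass_eq_iff:
  "q \<in> gpaths K \<Longrightarrow> hclass K p = hclass K q \<longleftrightarrow> homotopic K p q"
  unfolding hclass_def by (blast intro: homotopic_sym homotopic_trans)

context complex_of_groups
begin

interpretation base: scwol "base K"
  by (rule scwol_base)

declare base.ini_in [simp] base.ter_in [simp]

abbreviation conc (infixl "\<star>" 70) where "p \<star> q \<equiv> gconc K p q"
abbreviation htp (infix "\<simeq>" 50) where "p \<simeq> q \<equiv> homotopic K p q"

lemma oini_in: "oedge_of e \<in> edges (base K) \<Longrightarrow> oini (base K) e \<in> verts (base K)"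
  by (cases e) (auto intro: base.ini_in base.ter_in)

lemma oter_in: "oedge_of e \<in> edges (base K) \<Longrightarrow> oter (base K) e \<in> verts (base K)"
  by (cases e) (auto intro: base.ini_in base.ter_in)

lemma grp_one [simp]: "\<sigma> \<in> verts (base K) \<Longrightarrow> \<one>\<^bsub>grp K \<sigma>\<^esub> \<in> carrier (grp K \<sigma>)"
  using group_grp[of \<sigma>] by (simp add: group.is_monoid)

lemma grp_mult [simp]: "\<lbrakk>\<sigma> \<in> verts (base K); x \<in> carrier (grp K \<sigma>); y \<in> carrier (grp K \<sigma>)\<rbrakk>
    \<Longrightarrow> x \<otimes>\<^bsub>grp K \<sigma>\<^esub> y \<in> carrier (grp K \<sigma>)"
  using group_grp[of \<sigma>] by (simp add: group.is_monoid monoid.m_closed)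

lemma grp_inv [simp]: "\<lbrakk>\<sigma> \<in> verts (base K); x \<in> carrier (grp K \<sigma>)\<rbrakk>
    \<Longrightarrow> inv\<^bsub>grp K \<sigma>\<^esub> x \<in> carrier (grp K \<sigma>)"
  using group_grp[of \<sigma>] by (simp add: group.inv_closed)

lemma grp_l_one [simp]: "\<lbrakk>\<sigma> \<in> verts (base K); x \<in> carrier (grp K \<sigma>)\<rbrakk>
    \<Longrightarrow> \<one>\<^bsub>grp K \<sigma>\<^esub> \<otimes>\<^bsub>grp K \<sigma>\<^esub> x = x"
  using group_grp[of \<sigma>] by (simp add: group.is_monoid)

lemma grp_r_one [simp]: "\<lbrakk>\<sigma> \<in> verts (base K); x \<in> carrier (grp K \<sigma>)\<rbrakk>
    \<Longrightarrow> x \<otimes>\<^bsub>grp K \<sigma>\<^esub> \<one>\<^bsub>grp K \<sigma>\<^esub> = x"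
  using group_grp[of \<sigma>] by (simp add: group.is_monoid)

lemma psi_closed [simp]: "\<lbrakk>a \<in> edges (base K); x \<in> carrier (grp K (ini (base K) a))\<rbrakk>
    \<Longrightarrow> psi K a x \<in> carrier (grp K (ter (base K) a))"
  using psi_hom[of a] by (auto simp: hom_def)

lemma psi_one [simp]: "a \<in> edges (base K) \<Longrightarrow>
    psi K a \<one>\<^bsub>grp K (ini (base K) a)\<^esub> = \<one>\<^bsub>grp K (ter (base K) a)\<^esub>"
  using psi_hom[of a] by (intro hom_one) (auto intro: group_grp base.ini_in base.ter_in)

lemma gpaths_betw_verts:
  "p \<in> gpaths_betw K \<sigma> \<tau> \<Longrightarrow> \<sigma> \<in> verts (base K) \<and> \<tau> \<in> verts (base K)"
proof -
  have "(\<sigma>', g, xs) \<in> gpaths_betw K \<sigma> \<tau> \<Longrightarrow> \<sigma> \<in> verts (base K) \<and> \<tau> \<in> verts (base K)" for \<sigma>' g xs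
  proof (induction xs arbitrary: \<sigma> \<sigma>' g)
    case (Cons x xs)
    then show ?case by (cases x) (auto intro: oini_in)
  qed auto
  then show "p \<in> gpaths_betw K \<sigma> \<tau> \<Longrightarrow> \<sigma> \<in> verts (base K) \<and> \<tau> \<in> verts (base K)"
    by (cases p) auto
qed

lemma gconc_Cons:
  "(\<sigma>, g, (e, k) # xs) \<star> q =
    (\<sigma>, g, (e, fst (snd ((oter (base K) e, k, xs) \<star> q))) # snd (snd ((oter (base K) e, k, xs) \<star> q)))"
  by (simp split: prod.split)

lemma gconc_fst [simp]: "fst (p \<star> q) = fst p"
proof -
  obtain \<sigma> g xs where p: "p = (\<sigma>, g, xs)" by (cases p)
  show ?thesis unfolding p
    by (cases xs; cases q) (auto simp: gconc_Cons simp del: gconc.simps(2))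
qed

lemma gconc_in [intro]:
  assumes "p \<in> gpaths_betw K \<sigma> \<tau>" "q \<in> gpaths_betw K \<tau> \<rho>"
  shows "p \<star> q \<in> gpaths_betw K \<sigma> \<rho>"
proof -
  have "(\<sigma>', g, xs) \<in> gpaths_betw K \<sigma> \<tau> \<Longrightarrow> (\<sigma>', g, xs) \<star> q \<in> gpaths_betw K \<sigma> \<rho>" for \<sigma>' g xs
  proof (induction xs arbitrary: \<sigma> \<sigma>' g)
    case Nil
    obtain \<tau>' h ys where q: "q = (\<tau>', h, ys)" by (cases q)
    show ?case using Nil assms(2) unfolding q by (cases ys) auto
  next
    case (Cons x xs)
    obtain e k where x: "x = (e, k)" by (cases x)
    have *: "(oter (base K) e, k, xs) \<star> q \<in> gpaths_betw K (oter (base K) e) \<rho>"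
      using Cons.prems x by (intro Cons.IH) auto
    obtain k' zs where "(oter (base K) e, k, xs) \<star> q = (oter (base K) e, k', zs)"
      using gconc_fst[of "(oter (base K) e, k, xs)" q]
      by (metis fst_conv prod.exhaust)
    then show ?case using Cons.prems * x by (auto simp: gconc_Cons simp del: gconc.simps(2))
  qed
  then show ?thesis using assms(1) by (cases p) auto
qed

lemma gconc_assoc:
  assumes "p \<in> gpaths_betw K \<sigma> \<tau>" "q \<in> gpaths_betw K \<tau> \<rho>" "r \<in> gpaths_betw K \<rho> \<upsilon>"
  shows "(p \<star> q) \<star> r = p \<star> (q \<star> r)"
proof -
  obtain \<tau>' h ys where q: "q = (\<tau>', h, ys)" by (cases q)
  obtain \<rho>' k zs where r: "r = (\<rho>', k, zs)" by (cases r)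
  have k: "k \<in> carrier (grp K \<rho>)" "\<rho>' = \<rho>" using assms(3) r by (cases zs; auto)+
  have "(\<sigma>', g, xs) \<in> gpaths_betw K \<sigma> \<tau> \<Longrightarrow> ((\<sigma>', g, xs) \<star> q) \<star> r = (\<sigma>', g, xs) \<star> (q \<star> r)" for \<sigma>' g xs
  proof (induction xs arbitrary: \<sigma> \<sigma>' g)
    case Nil
    show ?case
    proof (cases ys)
      case Nil
      with k assms(2) \<open>(\<sigma>', g, []) \<in> gpaths_betw K \<sigma> \<tau>\<close> show ?thesis unfolding q r
        by (auto simp: monoid.m_assoc[OF group.is_monoid[OF group_grp]])
    next
      case (Cons y ys)
      then show ?thesis unfolding q
        by (cases y) (auto simp: gconc_Cons simp del: gconc.simps(2))
    qed
  next
    case (Cons x xs)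
    obtain e l where x: "x = (e, l)" by (cases x)
    have "((oter (base K) e, l, xs) \<star> q) \<star> r = (oter (base K) e, l, xs) \<star> (q \<star> r)"
      using Cons.prems x by (intro Cons.IH) auto
    moreover obtain k' zs where "(oter (base K) e, l, xs) \<star> q = (oter (base K) e, k', zs)"
      using gconc_fst[of "(oter (base K) e, l, xs)" q]
      by (metis fst_conv prod.exhaust)
    ultimately show ?case using x by (simp add: gconc_Cons del: gconc.simps(2))
  qed
  then show ?thesis using assms(1) by (cases p) auto
qed

lemma gconc_l_one:
  assumes "p \<in> gpaths_betw K \<sigma> \<tau>"
  shows "(\<sigma>, \<one>\<^bsub>grp K \<sigma>\<^esub>, []) \<star> p = p"
proof -
  obtain \<sigma>' g xs where p: "p = (\<sigma>', g, xs)" by (cases p)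
  have "\<sigma> \<in> verts (base K)" using assms gpaths_betw_verts by blast
  then show ?thesis using assms unfolding p by (cases xs) auto
qed

lemma gconc_r_one:
  assumes "p \<in> gpaths_betw K \<sigma> \<tau>"
  shows "p \<star> (\<tau>, \<one>\<^bsub>grp K \<tau>\<^esub>, []) = p"
proof -
  have "(\<sigma>', g, xs) \<in> gpaths_betw K \<sigma> \<tau> \<Longrightarrow> (\<sigma>', g, xs) \<star> (\<tau>, \<one>\<^bsub>grp K \<tau>\<^esub>, []) = (\<sigma>', g, xs)" for \<sigma>' g xs
  proof (induction xs arbitrary: \<sigma> \<sigma>' g)
    case (Cons x xs)
    obtain e l where x: "x = (e, l)" by (cases x)
    have "(oter (base K) e, l, xs) \<star> (\<tau>, \<one>\<^bsub>grp K \<tau>\<^esub>, []) = (oter (base K) e, l, xs)"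
      using Cons.prems x by (intro Cons.IH) auto
    then show ?case using x by (simp add: gconc_Cons del: gconc.simps(2))
  qed auto
  then show ?thesis using assms by (cases p) auto
qed

lemma one_path [simp, intro]:
  "\<sigma> \<in> verts (base K) \<Longrightarrow> (\<sigma>, \<one>\<^bsub>grp K \<sigma>\<^esub>, []) \<in> gpaths_betw K \<sigma> \<sigma>"
  by simp

lemma edges2D: "(a, b) \<in> edges2 (base K) \<Longrightarrow>
    a \<in> edges (base K) \<and> b \<in> edges (base K) \<and> ini (base K) a = ter (base K) b"
  by (simp add: edges2_def)

lemma edges2_verts: "(a, b) \<in> edges2 (base K) \<Longrightarrow>
    ini (base K) a \<in> verts (base K) \<and> ini (base K) b \<in> verts (base K) \<and>
    ter (base K) a \<in> verts (base K) \<and> ter (base K) b \<in> verts (base K)"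
  by (auto dest!: edges2D)

lemma gmove_in:
  "gmove K s s' \<Longrightarrow> \<exists>\<sigma> \<tau>. s \<in> gpaths_betw K \<sigma> \<tau> \<and> s' \<in> gpaths_betw K \<sigma> \<tau>"
  by (induction rule: gmove.induct)
    (auto simp: base.ini_cmp base.ter_cmp twist_in edges2_verts dest: edges2D
      intro: base.cmp_in)

lemma gstepE:
  assumes "gstep K p p'" "p \<in> gpaths_betw K \<sigma> \<tau> \<or> p' \<in> gpaths_betw K \<sigma> \<tau>"
  obtains u s s' v \<alpha> \<beta> where "gmove K s s'" "u \<in> gpaths_betw K \<sigma> \<alpha>" "s \<in> gpaths_betw K \<alpha> \<beta>"
    "s' \<in> gpaths_betw K \<alpha> \<beta>" "v \<in> gpaths_betw K \<beta> \<tau>" "p = u \<star> s \<star> v" "p' = u \<star> s' \<star> v"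
proof -
  from assms(1) obtain u s s' v where *: "gmove K s s'" "u \<in> gpaths K" "v \<in> gpaths K"
    "gtgt K u = gsrc s" "gtgt K s = gsrc v" "p = u \<star> s \<star> v" "p' = u \<star> s' \<star> v"
    by (auto elim!: gstep.cases)
  from gmove_in[OF *(1)] obtain \<alpha> \<beta> where s: "s \<in> gpaths_betw K \<alpha> \<beta>" "s' \<in> gpaths_betw K \<alpha> \<beta>"
    by blast
  have u: "u \<in> gpaths_betw K (gsrc u) \<alpha>" and v: "v \<in> gpaths_betw K \<beta> (gtgt K v)"
    using * s by (auto simp: gpaths_betw_def)
  have "p \<in> gpaths_betw K (gsrc u) (gtgt K v)" "p' \<in> gpaths_betw K (gsrc u) (gtgt K v)"
    using *(6,7) s u v by auto
  then have "gsrc u = \<sigma>" "gtgt K v = \<tau>" using assms(2) by (metis gpaths_betwD(2,3))+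
  with * s u v show thesis by (intro that) auto
qed

lemma gstep_in:
  assumes "gstep K p p'"
  shows "p \<in> gpaths_betw K \<sigma> \<tau> \<longleftrightarrow> p' \<in> gpaths_betw K \<sigma> \<tau>"
proof -
  have "p \<in> gpaths_betw K \<sigma> \<tau> \<and> p' \<in> gpaths_betw K \<sigma> \<tau>"
    if "p \<in> gpaths_betw K \<sigma> \<tau> \<or> p' \<in> gpaths_betw K \<sigma> \<tau>"
    using gstepE[OF assms that] by (metis gconc_in)
  then show ?thesis by blast
qed

lemma gstepI:
  assumes "gmove K s s'" "u \<in> gpaths_betw K \<sigma> \<alpha>" "s \<in> gpaths_betw K \<alpha> \<beta>"
    "v \<in> gpaths_betw K \<beta> \<tau>"
  shows "gstep K (u \<star> s \<star> v) (u \<star> s' \<star> v)"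
  using assms by (intro gstep.intros) (auto dest: gpaths_betwD)

lemma gmove_homotopic:
  assumes "gmove K s s'"
  shows "s \<simeq> s'"
proof -
  obtain \<sigma> \<tau> where s: "s \<in> gpaths_betw K \<sigma> \<tau>" "s' \<in> gpaths_betw K \<sigma> \<tau>" using gmove_in[OF assms] by blast
  then have v: "\<sigma> \<in> verts (base K)" "\<tau> \<in> verts (base K)" using gpaths_betw_verts by auto
  from gstepI[OF assms one_path[OF v(1)] s(1) one_path[OF v(2)]] s
  have "gstep K s s'" by (simp add: gconc_l_one gconc_r_one)
  then show ?thesis unfolding homotopic_def by blast
qed

lemma homotopic_in:
  assumes "p \<simeq> q" "p \<in> gpaths_betw K \<sigma> \<tau>"
  shows "q \<in> gpaths_betw K \<sigma> \<tau>"
  using assms unfolding homotopic_def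
proof (induction rule: equivclp_induct)
  case (step y z)
  then have "y \<in> gpaths_betw K \<sigma> \<tau>" by simp
  with step(2) show ?case by (auto dest: gstep_in[where \<sigma> = \<sigma> and \<tau> = \<tau>])
qed simp

lemma homotopic_map:
  assumes "p \<simeq> q" "p \<in> gpaths_betw K \<sigma> \<tau>"
    and "\<And>y z. \<lbrakk>y \<in> gpaths_betw K \<sigma> \<tau>; z \<in> gpaths_betw K \<sigma> \<tau>; gstep K y z\<rbrakk> \<Longrightarrow>
      homotopic L (f y) (f z)"
  shows "homotopic L (f p) (f q)"
  using assms(1)[unfolded homotopic_def]
proof (induction rule: equivclp_induct)
  case (step y z)
  from step(1) have y: "y \<in> gpaths_betw K \<sigma> \<tau>"
    using homotopic_in[OF _ assms(2)] unfolding homotopic_def by simp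
  from step(2) have "homotopic L (f y) (f z)"
  proof
    assume "gstep K y z"
    with y gstep_in[OF this] show ?thesis using assms(3) by simp
  next
    assume "gstep K z y"
    with y gstep_in[OF this] show ?thesis using assms(3)[of z y, THEN homotopic_sym] by simp
  qed
  with step.IH show ?case by (rule homotopic_trans)
qed simp

lemma homotopic_gconc:
  assumes "p \<simeq> p'" "q \<simeq> q'" "p \<in> gpaths_betw K \<sigma> \<tau>" "q \<in> gpaths_betw K \<tau> \<rho>"
  shows "p \<star> q \<simeq> p' \<star> q'"
proof -
  have p': "p' \<in> gpaths_betw K \<sigma> \<tau>" using homotopic_in assms by blast
  have "p \<star> q \<simeq> p' \<star> q"
  proof (rule homotopic_map[OF assms(1,3)])
    fix y z assume "y \<in> gpaths_betw K \<sigma> \<tau>" "gstep K y z"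
    then obtain u s s' v \<alpha> \<beta> where *: "gmove K s s'" "u \<in> gpaths_betw K \<sigma> \<alpha>" "s \<in> gpaths_betw K \<alpha> \<beta>"
      "s' \<in> gpaths_betw K \<alpha> \<beta>" "v \<in> gpaths_betw K \<beta> \<tau>" "y = u \<star> s \<star> v" "z = u \<star> s' \<star> v"
      by (auto elim: gstepE)
    have assoc: "u \<star> t \<star> v \<star> q = u \<star> t \<star> (v \<star> q)" if "t \<in> gpaths_betw K \<alpha> \<beta>" for t
      using gconc_assoc[OF gconc_in[OF *(2) that] *(5) assms(4)] .
    have "gstep K (y \<star> q) (z \<star> q)"
      using gstepI[OF *(1,2,3) gconc_in[OF *(5) assms(4)]] by (simp add: *(6,7) assoc *(3,4))
    then show "y \<star> q \<simeq> z \<star> q" unfolding homotopic_def by blast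
  qed
  also have "p' \<star> q \<simeq> p' \<star> q'"
  proof (rule homotopic_map[OF assms(2,4)])
    fix y z assume "y \<in> gpaths_betw K \<tau> \<rho>" "gstep K y z"
    then obtain u s s' v \<alpha> \<beta> where *: "gmove K s s'" "u \<in> gpaths_betw K \<tau> \<alpha>" "s \<in> gpaths_betw K \<alpha> \<beta>"
      "s' \<in> gpaths_betw K \<alpha> \<beta>" "v \<in> gpaths_betw K \<beta> \<rho>" "y = u \<star> s \<star> v" "z = u \<star> s' \<star> v"
      by (auto elim: gstepE)
    have assoc: "p' \<star> (u \<star> t \<star> v) = p' \<star> u \<star> t \<star> v" if "t \<in> gpaths_betw K \<alpha> \<beta>" for t
      using gconc_assoc[OF p' gconc_in[OF *(2) that] *(5)] gconc_assoc[OF p' *(2) that] by simp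
    have "gstep K (p' \<star> y) (p' \<star> z)"
      using gstepI[OF *(1) gconc_in[OF p' *(2)] *(3,5)] by (simp add: *(6,7) assoc *(3,4))
    then show "p' \<star> y \<simeq> p' \<star> z" unfolding homotopic_def by blast
  qed
  finally show ?thesis .
qed

end

section \<open>Paths in a scwol\<close>

lemma complex_of_groups_trivial_cog:
  assumes "scwol X"
  shows "complex_of_groups (trivial_cog X)"
  by (rule complex_of_groups.intro) (auto simp: trivial_cog_def assms hom_def)

definition unit_path :: "'v \<Rightarrow> 'e oedge list \<Rightarrow> ('v, 'e, unit) gpath" where
  "unit_path v es = (v, (), map (\<lambda>e. (e, ())) es)"

definition path_homotopic :: "('v, 'e) scwol_data \<Rightarrow> 'v \<Rightarrow> 'e oedge list \<Rightarrow> 'e oedge list \<Rightarrow> bool" where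
  "path_homotopic X v es fs = homotopic (trivial_cog X) (unit_path v es) (unit_path v fs)"

lemma base_trivial_cog [simp]: "base (trivial_cog X) = X"
  and carrier_trivial_cog [simp]: "carrier (grp (trivial_cog X) v) = UNIV"
  by (auto simp: trivial_cog_def singleton_group_def)

lemma unit_path_in [simp]: "unit_path v es \<in> gpaths_betw (trivial_cog X) v w \<longleftrightarrow> is_path X v es w"
  unfolding unit_path_def by (induction es arbitrary: v) auto

lemma gconc_unit_path [simp]:
  "gconc (trivial_cog X) (unit_path v es) (unit_path w fs) = unit_path v (es @ fs)"
  unfolding unit_path_def by (induction es arbitrary: v) auto

lemma gpath_unit_cases:
  fixes p :: "('v, 'e, unit) gpath"
  obtains es where "p = unit_path (gsrc p) es"
proof
  have "map (\<lambda>e. (e, ())) (map fst xs) = xs" for xs :: "('e oedge \<times> unit) list"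
    by (induction xs) auto
  then show "p = unit_path (gsrc p) (map fst (snd (snd p)))"
    by (cases p) (simp add: unit_path_def del: map_map)
qed

fun oflip :: "'e oedge \<Rightarrow> 'e oedge" where
  "oflip (Fwd a) = Bwd a"
| "oflip (Bwd a) = Fwd a"

lemma oflip_simps [simp]:
  "oedge_of (oflip e) = oedge_of e" "oini X (oflip e) = oter X e" "oter X (oflip e) = oini X e"
  "oflip (oflip e) = e"
  by (cases e; simp)+

lemma path_homotopic_refl [simp, intro]: "path_homotopic X v es es"
  by (simp add: path_homotopic_def)

lemma path_homotopic_sym: "path_homotopic X v es fs \<Longrightarrow> path_homotopic X v fs es"
  by (simp add: path_homotopic_def homotopic_sym)

lemma path_homotopic_trans [trans]:
  "path_homotopic X v es fs \<Longrightarrow> path_homotopic X v fs gs \<Longrightarrow> path_homotopic X v es gs"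
  unfolding path_homotopic_def by (rule homotopic_trans)

lemma is_path_unique: "is_path X u es v \<Longrightarrow> is_path X u es w \<Longrightarrow> v = w"
  by (induction es arbitrary: u) auto

context scwol
begin

interpretation triv: complex_of_groups "trivial_cog X"
  by (rule complex_of_groups_trivial_cog) unfold_locales

lemma is_path_in: "is_path X v es w \<Longrightarrow> v \<in> verts X" "is_path X v es w \<Longrightarrow> w \<in> verts X"
  using triv.gpaths_betw_verts[of "unit_path v es" v w] by auto

lemma is_path_append: "is_path X u es v \<Longrightarrow> is_path X v fs w \<Longrightarrow> is_path X u (es @ fs) w"
  by (induction es arbitrary: u) auto

lemma is_path_single: "oedge_of e \<in> edges X \<Longrightarrow> is_path X (oini X e) [e] (oter X e)"
  using triv.oter_in[of e] by simp

lemma is_path_rev: "is_path X u es v \<Longrightarrow> is_path X v (rev (map oflip es)) u"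
proof (induction es arbitrary: u)
  case (Cons e es)
  then have "is_path X v (rev (map oflip es)) (oter X e)" by simp
  moreover have "is_path X (oter X e) [oflip e] u"
    using is_path_single[of "oflip e"] Cons.prems by simp
  ultimately have "is_path X v (rev (map oflip es) @ [oflip e]) u" by (rule is_path_append)
  then show ?case by simp
qed auto

lemma path_homotopic_append:
  assumes "path_homotopic X u es es'" "path_homotopic X v fs fs'"
    "is_path X u es v" "is_path X v fs w"
  shows "path_homotopic X u (es @ fs) (es' @ fs')"
  using triv.homotopic_gconc[of "unit_path u es" "unit_path u es'" "unit_path v fs" "unit_path v fs'" u v w]
    assms by (simp add: path_homotopic_def)

lemma path_homotopic_flip:
  assumes "oedge_of e \<in> edges X"
  shows "path_homotopic X (oini X e) [e, oflip e] []"
proof (cases e)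
  case (Fwd a)
  with assms have "gmove (trivial_cog X) (unit_path (ini X a) [Fwd a, Bwd a]) (unit_path (ini X a) [])"
    using gmove.cancel_fwd[of a "trivial_cog X" "ini X a" "()" "()" "()"]
    by (simp add: unit_path_def)
  from triv.gmove_homotopic[OF this] show ?thesis by (simp add: path_homotopic_def Fwd)
next
  case (Bwd a)
  with assms have "gmove (trivial_cog X) (unit_path (ter X a) [Bwd a, Fwd a]) (unit_path (ter X a) [])"
    using gmove.cancel_bwd[of a "trivial_cog X" "ini X a" "ter X a" "()" "()" "()"]
    by (simp add: unit_path_def)
  from triv.gmove_homotopic[OF this] show ?thesis by (simp add: path_homotopic_def Bwd)
qed

lemma path_homotopic_cmp_fwd:
  assumes "(a, b) \<in> edges2 X"
  shows "path_homotopic X (ini X b) [Fwd b, Fwd a] [Fwd (cmp X a b)]"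
proof -
  have "gmove (trivial_cog X) (unit_path (ini X b) [Fwd b, Fwd a]) (unit_path (ini X b) [Fwd (cmp X a b)])"
    using assms gmove.comp_fwd[of a b "trivial_cog X" "ini X b" "ter X a" "()" "()"]
    by (simp add: unit_path_def)
  from triv.gmove_homotopic[OF this] show ?thesis by (simp add: path_homotopic_def)
qed

lemma path_homotopic_cmp_bwd:
  assumes "(a, b) \<in> edges2 X"
  shows "path_homotopic X (ter X a) [Bwd a, Bwd b] [Bwd (cmp X a b)]"
proof -
  have "gmove (trivial_cog X) (unit_path (ter X a) [Bwd a, Bwd b]) (unit_path (ter X a) [Bwd (cmp X a b)])"
    using assms gmove.comp_bwd[of a b "trivial_cog X" "ini X b" "ter X a" "()" "()"]
    by (simp add: unit_path_def)
  from triv.gmove_homotopic[OF this] show ?thesis by (simp add: path_homotopic_def)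
qed

lemma path_homotopic_cancel_prefix:
  assumes "is_path X u ds v" "is_path X v es w" "is_path X v fs w'"
    "path_homotopic X u (ds @ es) (ds @ fs)"
  shows "path_homotopic X v es fs"
  using assms(1,4)
proof (induction ds arbitrary: u)
  case (Cons d ds)
  let ?t = "oter X d"
  have d: "oedge_of d \<in> edges X" "oini X d = u" "is_path X ?t ds v" using Cons.prems by auto
  have es: "is_path X ?t (ds @ es) w" and fs: "is_path X ?t (ds @ fs) w'"
    using d assms by (auto intro: is_path_append)
  have flip: "is_path X ?t [oflip d] u" "is_path X ?t [oflip d, d] ?t"
    "path_homotopic X ?t [oflip d, d] []"
    using path_homotopic_flip[of "oflip d"] d triv.oini_in triv.oter_in by fastforce+
  have collapse: "path_homotopic X ?t ([oflip d, d] @ ds @ hs) (ds @ hs)"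
    if "is_path X ?t (ds @ hs) x" for hs x
    using path_homotopic_append[OF flip(3) path_homotopic_refl flip(2) that] by simp
  have "path_homotopic X ?t (ds @ es) ([oflip d, d] @ ds @ es)"
    using collapse[OF es] by (rule path_homotopic_sym)
  also have "path_homotopic X ?t ([oflip d, d] @ ds @ es) ([oflip d, d] @ ds @ fs)"
    using path_homotopic_append[OF path_homotopic_refl Cons.prems(2) flip(1)] es d by simp
  also have "path_homotopic X ?t ([oflip d, d] @ ds @ fs) (ds @ fs)"
    using collapse[OF fs] .
  finally show ?case using Cons.IH d(3) by blast
qed auto

lemma simply_connectedI:
  assumes "connected_scwol X"
    and null: "\<And>v es. is_path X v es v \<Longrightarrow> path_homotopic X v es []"
  shows "simply_connected_scwol X"
  unfolding simply_connected_scwol_def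
proof (intro conjI ballI)
  fix v assume v: "v \<in> verts X"
  let ?T = "trivial_cog X"
  have null': "homotopic ?T (unit_path v []) p" if "p \<in> gpaths_betw ?T v v" for p
  proof -
    obtain es where "p = unit_path (gsrc p) es" by (rule gpath_unit_cases)
    with gpaths_betwD(2)[OF that] have p: "p = unit_path v es" by simp
    with that null[of v es] have "path_homotopic X v es []" by simp
    then show ?thesis unfolding p path_homotopic_def by (rule homotopic_sym)
  qed
  have unit_in: "unit_path v [] \<in> gpaths_betw ?T v v" using v by simp
  have one: "\<one>\<^bsub>scwol_pi1 X v\<^esub> = hclass ?T (unit_path v [])"
    by (simp add: scwol_pi1_def cog_pi1_def unit_path_def)
  have class_eq: "hclass ?T p = hclass ?T (unit_path v [])" if "p \<in> gpaths_betw ?T v v" for p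
    using hclass_eq_iff[of p ?T "unit_path v []"] null'[OF that] gpaths_betwD(1)[OF that] by simp
  have class_set: "hclass ?T (unit_path v []) = gpaths_betw ?T v v"
  proof (intro equalityI subsetI)
    show "p \<in> gpaths_betw ?T v v" if "p \<in> hclass ?T (unit_path v [])" for p
      using that triv.homotopic_in[OF _ unit_in] by (simp add: hclass_def)
    show "p \<in> hclass ?T (unit_path v [])" if "p \<in> gpaths_betw ?T v v" for p
      using null'[OF that] gpaths_betwD(1)[OF that] by (simp add: hclass_def)
  qed
  have carrier: "carrier (scwol_pi1 X v) = {\<one>\<^bsub>scwol_pi1 X v\<^esub>}"
  proof -
    have "{p \<in> gpaths_from ?T v. gtgt ?T p = v} = gpaths_betw ?T v v"
      by (auto simp: gpaths_from_def gpaths_betw_def)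
    then have "carrier (scwol_pi1 X v) = hclass ?T ` gpaths_betw ?T v v"
      by (simp add: scwol_pi1_def cog_pi1_def)
    also have "\<dots> = {hclass ?T (unit_path v [])}" using class_eq unit_in by blast
    finally show ?thesis by (simp add: one)
  qed
  have "\<one>\<^bsub>scwol_pi1 X v\<^esub> \<otimes>\<^bsub>scwol_pi1 X v\<^esub> \<one>\<^bsub>scwol_pi1 X v\<^esub> =
      (\<Union>p\<in>gpaths_betw ?T v v. \<Union>q\<in>gpaths_betw ?T v v. hclass ?T (gconc ?T p q))"
    unfolding one class_set by (simp add: scwol_pi1_def cog_pi1_def)
  also have "\<dots> = (\<Union>p\<in>gpaths_betw ?T v v. \<Union>q\<in>gpaths_betw ?T v v. gpaths_betw ?T v v)"
    by (intro SUP_cong refl) (simp add: class_eq[OF triv.gconc_in] class_set)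
  also have "\<dots> = \<one>\<^bsub>scwol_pi1 X v\<^esub>" using unit_in by (auto simp: one class_set)
  finally have mult: "\<one>\<^bsub>scwol_pi1 X v\<^esub> \<otimes>\<^bsub>scwol_pi1 X v\<^esub> \<one>\<^bsub>scwol_pi1 X v\<^esub> = \<one>\<^bsub>scwol_pi1 X v\<^esub>" .
  have "group (scwol_pi1 X v)"
    by (rule groupI) (auto simp: carrier mult)
  with carrier show "trivial_group (scwol_pi1 X v)"
    by (simp add: trivial_group_def)
qed (rule assms(1))

end

section \<open>The universal complex as a scwol\<close>

locale pointed_complex_of_groups = complex_of_groups +
  fixes \<sigma>\<^sub>0
  assumes \<sigma>\<^sub>0_in: "\<sigma>\<^sub>0 \<in> verts (base K)"
begin

interpretation base: scwol "base K"
  by (rule scwol_base)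

abbreviation cls where "cls \<equiv> eclass K \<sigma>\<^sub>0"
abbreviation Y where "Y \<equiv> universal_complex K \<sigma>\<^sub>0"
abbreviation (input) edge_path where
  "edge_path g e \<equiv> (oini (base K) e, g, [(e, \<one>\<^bsub>grp K (oter (base K) e)\<^esub>)])"

lemma edge_path_in:
  "\<lbrakk>oedge_of e \<in> edges (base K); g \<in> carrier (grp K (oini (base K) e))\<rbrakk> \<Longrightarrow>
    edge_path g e \<in> gpaths_betw K (oini (base K) e) (oter (base K) e)"
  by (simp add: oter_in)

lemma end_path_in:
  "\<lbrakk>p \<in> gpaths_betw K \<sigma> \<tau>; g \<in> carrier (grp K \<tau>)\<rbrakk> \<Longrightarrow> (\<tau>, g, []) \<in> gpaths_betw K \<tau> \<tau>"
  using gpaths_betw_verts by auto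

lemma mem_eclass:
  assumes "p \<in> gpaths_betw K \<sigma>\<^sub>0 \<tau>"
  shows "q \<in> cls p \<longleftrightarrow> (\<exists>g\<in>carrier (grp K \<tau>). q \<simeq> p \<star> (\<tau>, g, []))"
proof -
  have in': "p \<star> (\<tau>, g, []) \<in> gpaths_betw K \<sigma>\<^sub>0 \<tau>" if "g \<in> carrier (grp K \<tau>)" for g
    by (rule gconc_in[OF assms end_path_in[OF assms that]])
  have "q \<in> gpaths_from K \<sigma>\<^sub>0" if "q \<simeq> p \<star> (\<tau>, g, [])" "g \<in> carrier (grp K \<tau>)" for g
    using homotopic_in[OF homotopic_sym[OF that(1)] in'[OF that(2)]]
    by (auto simp: gpaths_from_def gpaths_betw_def)
  moreover have "hclass K q = hclass K (p \<star> (\<tau>, g, [])) \<longleftrightarrow> q \<simeq> p \<star> (\<tau>, g, [])"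
    if "g \<in> carrier (grp K \<tau>)" for g
    using gpaths_betwD(1)[OF in'[OF that]] by (rule hclass_eq_iff)
  ultimately show ?thesis
    unfolding eclass_def end_equiv_def gpaths_betwD(3)[OF assms] by auto
qed

lemma eclass_in:
  assumes "p \<in> gpaths_betw K \<sigma>\<^sub>0 \<tau>" "q \<in> cls p"
  shows "q \<in> gpaths_betw K \<sigma>\<^sub>0 \<tau>"
proof -
  obtain g where g: "g \<in> carrier (grp K \<tau>)" "q \<simeq> p \<star> (\<tau>, g, [])"
    using assms(2) unfolding mem_eclass[OF assms(1)] by (rule bexE)
  show ?thesis
    using homotopic_in[OF homotopic_sym[OF g(2)] gconc_in[OF assms(1) end_path_in[OF assms(1) g(1)]]] .
qed

lemma eclass_refl:
  assumes "p \<in> gpaths_betw K \<sigma>\<^sub>0 \<tau>"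
  shows "p \<in> cls p"
  unfolding mem_eclass[OF assms] using gpaths_betw_verts[OF assms]
  by (intro bexI[of _ "\<one>\<^bsub>grp K \<tau>\<^esub>"]) (simp_all add: gconc_r_one[OF assms])

lemma eclass_trans:
  assumes p: "p \<in> gpaths_betw K \<sigma>\<^sub>0 \<tau>" and "q \<in> cls p" "r \<in> cls q"
  shows "r \<in> cls p"
proof -
  have \<tau>: "\<tau> \<in> verts (base K)" using gpaths_betw_verts[OF p] by simp
  have q: "q \<in> gpaths_betw K \<sigma>\<^sub>0 \<tau>" using assms(1,2) by (rule eclass_in)
  obtain g where g: "g \<in> carrier (grp K \<tau>)" "q \<simeq> p \<star> (\<tau>, g, [])"
    using assms(2) unfolding mem_eclass[OF p] by (rule bexE)
  obtain h where h: "h \<in> carrier (grp K \<tau>)" "r \<simeq> q \<star> (\<tau>, h, [])"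
    using assms(3) unfolding mem_eclass[OF q] by (rule bexE)
  have in': "(\<tau>, g, []) \<in> gpaths_betw K \<tau> \<tau>" "(\<tau>, h, []) \<in> gpaths_betw K \<tau> \<tau>"
    using \<tau> g h by auto
  note h(2)
  also have "q \<star> (\<tau>, h, []) \<simeq> p \<star> (\<tau>, g, []) \<star> (\<tau>, h, [])"
    using homotopic_gconc[OF g(2) homotopic_refl q in'(2)] .
  also have "p \<star> (\<tau>, g, []) \<star> (\<tau>, h, []) = p \<star> (\<tau>, g \<otimes>\<^bsub>grp K \<tau>\<^esub> h, [])"
    using gconc_assoc[OF p in'] by simp
  finally show ?thesis using mem_eclass[OF p] g h \<tau> by auto
qed

lemma eclass_sym:
  assumes p: "p \<in> gpaths_betw K \<sigma>\<^sub>0 \<tau>" and "q \<in> cls p"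
  shows "p \<in> cls q"
proof -
  have \<tau>: "\<tau> \<in> verts (base K)" using gpaths_betw_verts[OF p] by simp
  interpret group "grp K \<tau>" using \<tau> by (rule group_grp)
  have q: "q \<in> gpaths_betw K \<sigma>\<^sub>0 \<tau>" using assms by (rule eclass_in)
  obtain g where g: "g \<in> carrier (grp K \<tau>)" "q \<simeq> p \<star> (\<tau>, g, [])"
    using assms(2) unfolding mem_eclass[OF p] by (rule bexE)
  let ?g' = "inv\<^bsub>grp K \<tau>\<^esub> g"
  have in': "(\<tau>, g, []) \<in> gpaths_betw K \<tau> \<tau>" "(\<tau>, ?g', []) \<in> gpaths_betw K \<tau> \<tau>"
    using \<tau> g by auto
  have "q \<star> (\<tau>, ?g', []) \<simeq> p \<star> (\<tau>, g, []) \<star> (\<tau>, ?g', [])"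
    using homotopic_gconc[OF g(2) homotopic_refl q in'(2)] .
  also have "p \<star> (\<tau>, g, []) \<star> (\<tau>, ?g', []) = p"
    using gconc_assoc[OF p in'] g gconc_r_one[OF p] by (simp add: r_inv)
  finally have "p \<simeq> q \<star> (\<tau>, ?g', [])" by (rule homotopic_sym)
  then show ?thesis using mem_eclass[OF q] g by auto
qed

lemma eclass_eqI:
  assumes "p \<in> gpaths_betw K \<sigma>\<^sub>0 \<tau>" "q \<in> cls p"
  shows "cls q = cls p"
  using eclass_trans[OF assms(1) assms(2)] eclass_trans[OF eclass_in[OF assms] eclass_sym[OF assms]]
  by blast

lemma eclass_homotopic:
  assumes "p \<in> gpaths_betw K \<sigma>\<^sub>0 \<tau>" "p \<simeq> q"
  shows "cls q = cls p"
proof (rule eclass_eqI[OF assms(1)])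
  show "q \<in> cls p"
    unfolding mem_eclass[OF assms(1)] using gpaths_betw_verts[OF assms(1)] homotopic_sym[OF assms(2)]
    by (intro bexI[of _ "\<one>\<^bsub>grp K \<tau>\<^esub>"]) (simp_all add: gconc_r_one[OF assms(1)])
qed

lemma eclass_end:
  assumes "p \<in> gpaths_betw K \<sigma>\<^sub>0 \<tau>" "g \<in> carrier (grp K \<tau>)"
  shows "cls (p \<star> (\<tau>, g, [])) = cls p"
proof (rule eclass_eqI[OF assms(1)])
  show "p \<star> (\<tau>, g, []) \<in> cls p"
    unfolding mem_eclass[OF assms(1)] using assms(2) by (blast intro: homotopic_refl)
qed

lemma eclass_eqD:
  assumes "p \<in> gpaths_betw K \<sigma>\<^sub>0 \<tau>" "q \<in> gpaths_betw K \<sigma>\<^sub>0 \<rho>" "cls q = cls p"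
  obtains g where "g \<in> carrier (grp K \<tau>)" "q \<simeq> p \<star> (\<tau>, g, [])" "\<rho> = \<tau>"
proof -
  have q: "q \<in> cls p" using eclass_refl[OF assms(2)] assms(3) by simp
  have "\<rho> = \<tau>" using gpaths_betwD(3)[OF eclass_in[OF assms(1) q]] gpaths_betwD(3)[OF assms(2)] by simp
  with q show thesis unfolding mem_eclass[OF assms(1)] using that by blast
qed

lemma gsnoc_in:
  assumes "p \<in> gpaths_betw K \<sigma> (ini (base K) a)" "a \<in> edges (base K)"
  shows "gsnoc K p a \<in> gpaths_betw K \<sigma> (ter (base K) a)"
  using assms unfolding gsnoc_def by auto

text \<open>The local element in front of an edge does not change the vertex reached, because it can be
  moved across the edge and there becomes an end factor.\<close>

lemma eclass_edge_fwd:
  assumes "p \<in> gpaths_betw K \<sigma>\<^sub>0 (ini (base K) a)" "a \<in> edges (base K)"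
    "g \<in> carrier (grp K (ini (base K) a))"
  shows "cls (p \<star> edge_path g (Fwd a)) = cls (gsnoc K p a)"
proof -
  let ?\<sigma> = "ini (base K) a" and ?\<tau> = "ter (base K) a"
  let ?s = "edge_path \<one>\<^bsub>grp K ?\<sigma>\<^esub> (Fwd a)"
  have "gmove K (edge_path g (Fwd a)) (?\<sigma>, \<one>\<^bsub>grp K ?\<sigma>\<^esub>, [(Fwd a, psi K a g)])"
    using gmove.slide_fwd[OF assms(2) refl refl, of "\<one>\<^bsub>grp K ?\<sigma>\<^esub>" g "\<one>\<^bsub>grp K ?\<tau>\<^esub>"] assms by simp
  moreover have "(?\<sigma>, \<one>\<^bsub>grp K ?\<sigma>\<^esub>, [(Fwd a, psi K a g)]) = ?s \<star> (?\<tau>, psi K a g, [])"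
    using assms by simp
  ultimately have slide: "edge_path g (Fwd a) \<simeq> ?s \<star> (?\<tau>, psi K a g, [])"
    using gmove_homotopic by metis
  have s: "?s \<in> gpaths_betw K ?\<sigma> ?\<tau>" "edge_path g (Fwd a) \<in> gpaths_betw K ?\<sigma> ?\<tau>"
    "(?\<tau>, psi K a g, []) \<in> gpaths_betw K ?\<tau> ?\<tau>"
    using assms by auto
  have "p \<star> edge_path g (Fwd a) \<simeq> p \<star> (?s \<star> (?\<tau>, psi K a g, []))"
    by (rule homotopic_gconc[OF homotopic_refl slide assms(1) s(2)])
  also have "\<dots> = gsnoc K p a \<star> (?\<tau>, psi K a g, [])"
    using gconc_assoc[OF assms(1) s(1,3)] by (simp add: gsnoc_def)
  finally have "cls (p \<star> edge_path g (Fwd a)) = cls (gsnoc K p a \<star> (?\<tau>, psi K a g, []))"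
    using eclass_homotopic[OF gconc_in[OF assms(1) s(2)]] by metis
  also have "\<dots> = cls (gsnoc K p a)"
    using assms by (intro eclass_end gsnoc_in) auto
  finally show ?thesis .
qed

lemma eclass_gsnoc_cong:
  assumes "p \<in> gpaths_betw K \<sigma>\<^sub>0 (ini (base K) a)" "q \<in> gpaths_betw K \<sigma>\<^sub>0 \<rho>" "cls q = cls p"
    "a \<in> edges (base K)"
  shows "cls (gsnoc K q a) = cls (gsnoc K p a)"
proof -
  let ?\<sigma> = "ini (base K) a" and ?\<tau> = "ter (base K) a"
  let ?s = "edge_path \<one>\<^bsub>grp K ?\<sigma>\<^esub> (Fwd a)"
  obtain g where g: "g \<in> carrier (grp K ?\<sigma>)" "q \<simeq> p \<star> (?\<sigma>, g, [])" "\<rho> = ?\<sigma>"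
    using eclass_eqD[OF assms(1-3)] by blast
  have q: "q \<in> gpaths_betw K \<sigma>\<^sub>0 ?\<sigma>" using assms(2) g(3) by simp
  have s: "?s \<in> gpaths_betw K ?\<sigma> ?\<tau>" "(?\<sigma>, g, []) \<in> gpaths_betw K ?\<sigma> ?\<sigma>"
    using assms g by auto
  have "gsnoc K q a = q \<star> ?s" by (simp add: gsnoc_def)
  also have "q \<star> ?s \<simeq> p \<star> (?\<sigma>, g, []) \<star> ?s"
    by (rule homotopic_gconc[OF g(2) homotopic_refl q s(1)])
  also have "\<dots> = p \<star> edge_path g (Fwd a)"
    using gconc_assoc[OF assms(1) s(2,1)] g assms by simp
  finally have "cls (p \<star> edge_path g (Fwd a)) = cls (gsnoc K q a)"
    by (rule eclass_homotopic[OF gsnoc_in[OF q assms(4)]])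
  then show ?thesis using eclass_edge_fwd[OF assms(1,4) g(1)] by simp
qed

lemma eclass_edge_bwd:
  assumes "p \<in> gpaths_betw K \<sigma>\<^sub>0 (ter (base K) a)" "a \<in> edges (base K)"
    "g \<in> carrier (grp K (ter (base K) a))"
  shows "cls (gsnoc K (p \<star> edge_path g (Bwd a)) a) = cls p"
proof -
  let ?\<sigma> = "ini (base K) a" and ?\<tau> = "ter (base K) a"
  let ?s = "edge_path g (Bwd a)" and ?t = "edge_path \<one>\<^bsub>grp K ?\<sigma>\<^esub> (Fwd a)"
  have in': "?s \<in> gpaths_betw K ?\<tau> ?\<sigma>" "?t \<in> gpaths_betw K ?\<sigma> ?\<tau>" using assms by auto
  have "gmove K (?s \<star> ?t) (?\<tau>, g, [])"
    using gmove.cancel_bwd[OF assms(2) refl refl, of g "\<one>\<^bsub>grp K ?\<sigma>\<^esub>" "\<one>\<^bsub>grp K ?\<tau>\<^esub>"] assms by simp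
  then have cancel: "?s \<star> ?t \<simeq> (?\<tau>, g, [])" by (rule gmove_homotopic)
  have "gsnoc K (p \<star> ?s) a = p \<star> (?s \<star> ?t)"
    using gconc_assoc[OF assms(1) in'] by (simp add: gsnoc_def)
  also have "\<dots> \<simeq> p \<star> (?\<tau>, g, [])"
    by (rule homotopic_gconc[OF homotopic_refl cancel assms(1) gconc_in[OF in']])
  finally have "cls (p \<star> (?\<tau>, g, [])) = cls (gsnoc K (p \<star> ?s) a)"
    by (rule eclass_homotopic[OF gsnoc_in[OF gconc_in[OF assms(1) in'(1)] assms(2)]])
  then show ?thesis using eclass_end[OF assms(1,3)] by simp
qed

lemma eclass_cmp:
  assumes "p \<in> gpaths_betw K \<sigma>\<^sub>0 (ini (base K) b)" "(a, b) \<in> edges2 (base K)"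
  shows "cls (gsnoc K (gsnoc K p b) a) = cls (gsnoc K p (cmp (base K) a b))"
proof -
  let ?\<sigma> = "ini (base K) b" and ?\<tau> = "ter (base K) b" and ?\<rho> = "ter (base K) a"
    and ?c = "cmp (base K) a b"
  let ?s = "edge_path \<one>\<^bsub>grp K ?\<sigma>\<^esub> (Fwd b)" and ?t = "edge_path \<one>\<^bsub>grp K ?\<tau>\<^esub> (Fwd a)"
    and ?r = "edge_path \<one>\<^bsub>grp K ?\<sigma>\<^esub> (Fwd ?c)"
  let ?g = "inv\<^bsub>grp K ?\<rho>\<^esub> twist K a b"
  have ab: "a \<in> edges (base K)" "b \<in> edges (base K)" "ini (base K) a = ?\<tau>" "?c \<in> edges (base K)"
    "ini (base K) ?c = ?\<sigma>" "ter (base K) ?c = ?\<rho>"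
    using edges2D[OF assms(2)] base.cmp_in[OF assms(2)] base.ini_cmp[OF assms(2)]
      base.ter_cmp[OF assms(2)] by auto
  have v: "?\<sigma> \<in> verts (base K)" "?\<tau> \<in> verts (base K)" "?\<rho> \<in> verts (base K)" using ab by auto
  have g: "?g \<in> carrier (grp K ?\<rho>)" using v twist_in[OF assms(2)] by simp
  have in': "?s \<in> gpaths_betw K ?\<sigma> ?\<tau>" "?t \<in> gpaths_betw K ?\<tau> ?\<rho>" "?r \<in> gpaths_betw K ?\<sigma> ?\<rho>"
    "(?\<rho>, ?g, []) \<in> gpaths_betw K ?\<rho> ?\<rho>"
    using ab v g by auto
  have "gmove K (?s \<star> ?t) (?r \<star> (?\<rho>, ?g, []))"
    using gmove.comp_fwd[OF assms(2) refl refl, of "\<one>\<^bsub>grp K ?\<sigma>\<^esub>" "\<one>\<^bsub>grp K ?\<rho>\<^esub>"] v g ab by simp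
  then have move: "?s \<star> ?t \<simeq> ?r \<star> (?\<rho>, ?g, [])" by (rule gmove_homotopic)
  have pb: "gsnoc K p b \<in> gpaths_betw K \<sigma>\<^sub>0 (ini (base K) a)"
    using gsnoc_in[OF assms(1) ab(2)] unfolding ab(3) .
  have pc: "gsnoc K p ?c \<in> gpaths_betw K \<sigma>\<^sub>0 ?\<rho>"
    using gsnoc_in[of p \<sigma>\<^sub>0 ?c, unfolded ab(5,6), OF assms(1) ab(4)] .
  have l: "gsnoc K (gsnoc K p b) a = p \<star> (?s \<star> ?t)"
    using gconc_assoc[OF assms(1) in'(1,2)] by (simp add: gsnoc_def ab(3))
  have r: "gsnoc K p ?c \<star> (?\<rho>, ?g, []) = p \<star> (?r \<star> (?\<rho>, ?g, []))"
    using gconc_assoc[OF assms(1) in'(3,4)] by (simp only: gsnoc_def ab(5,6) oini.simps oter.simps)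
  have "gsnoc K (gsnoc K p b) a \<simeq> gsnoc K p ?c \<star> (?\<rho>, ?g, [])"
    unfolding l r by (rule homotopic_gconc[OF homotopic_refl move assms(1) gconc_in[OF in'(1,2)]])
  then have "cls (gsnoc K p ?c \<star> (?\<rho>, ?g, [])) = cls (gsnoc K (gsnoc K p b) a)"
    by (rule eclass_homotopic[OF gsnoc_in[OF pb ab(1)]])
  moreover have "cls (gsnoc K p ?c \<star> (?\<rho>, ?g, [])) = cls (gsnoc K p ?c)"
    using pc g by (rule eclass_end)
  ultimately show ?thesis by simp
qed

lemma verts_Y: "P \<in> verts Y \<longleftrightarrow> (\<exists>p. p \<in> gpaths_betw K \<sigma>\<^sub>0 (gtgt K p) \<and> P = cls p)"
  by (auto simp: universal_complex_def gpaths_from_iff[symmetric])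

lemma vert_Y [intro]: "p \<in> gpaths_betw K \<sigma>\<^sub>0 \<tau> \<Longrightarrow> cls p \<in> verts Y"
  unfolding verts_Y by (intro exI[of _ p]) (simp add: gpaths_betwD(3))

lemma edge_Y: "\<lbrakk>p \<in> gpaths_betw K \<sigma>\<^sub>0 (ini (base K) a); a \<in> edges (base K)\<rbrakk> \<Longrightarrow>
    (cls p, a, cls (gsnoc K p a)) \<in> edges Y"
  using gpaths_from_iff[of p K \<sigma>\<^sub>0] unfolding universal_complex_def
  by (auto simp: gpaths_betwD(3) simp del: split_paired_Ex)

lemma edge_Y_E:
  assumes "E \<in> edges Y"
  obtains p a where "p \<in> gpaths_betw K \<sigma>\<^sub>0 (ini (base K) a)" "a \<in> edges (base K)"
    "E = (cls p, a, cls (gsnoc K p a))"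
  using assms by (auto simp: universal_complex_def gpaths_from_iff)

lemma ini_Y [simp]: "ini Y (P, a, Q) = P" and ter_Y [simp]: "ter Y (P, a, Q) = Q"
  by (simp_all add: universal_complex_def)

lemma edges2_Y_E:
  assumes "(E, F) \<in> edges2 Y"
  obtains p a b where "p \<in> gpaths_betw K \<sigma>\<^sub>0 (ini (base K) b)" "(a, b) \<in> edges2 (base K)"
    "E = (cls (gsnoc K p b), a, cls (gsnoc K (gsnoc K p b) a))" "F = (cls p, b, cls (gsnoc K p b))"
proof -
  from assms have EF: "E \<in> edges Y" "F \<in> edges Y" "ini Y E = ter Y F" by (auto simp: edges2_def)
  obtain q a where q: "q \<in> gpaths_betw K \<sigma>\<^sub>0 (ini (base K) a)" "a \<in> edges (base K)"
    "E = (cls q, a, cls (gsnoc K q a))" using edge_Y_E[OF EF(1)] .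
  obtain p b where p: "p \<in> gpaths_betw K \<sigma>\<^sub>0 (ini (base K) b)" "b \<in> edges (base K)"
    "F = (cls p, b, cls (gsnoc K p b))" using edge_Y_E[OF EF(2)] .
  have eq: "cls (gsnoc K p b) = cls q" using EF(3) p q by simp
  have pb: "gsnoc K p b \<in> gpaths_betw K \<sigma>\<^sub>0 (ter (base K) b)" using gsnoc_in p by blast
  have "ter (base K) b = ini (base K) a" using eclass_eqD[OF q(1) pb eq] by blast
  then have "(a, b) \<in> edges2 (base K)" using p q by (simp add: edges2_def)
  moreover have "cls (gsnoc K (gsnoc K p b) a) = cls (gsnoc K q a)"
    using eclass_gsnoc_cong[OF q(1) pb eq q(2)] .
  ultimately show thesis using that[OF p(1)] p q eq by simp
qed

lemma cmp_Y:
  assumes "((Q, a, R), (P, b, Q')) \<in> edges2 Y"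
  shows "cmp Y (Q, a, R) (P, b, Q') = (P, cmp (base K) a b, R)"
    and "(P, cmp (base K) a b, R) \<in> edges Y" and "(a, b) \<in> edges2 (base K)"
proof -
  obtain p where p: "p \<in> gpaths_betw K \<sigma>\<^sub>0 (ini (base K) b)" "(a, b) \<in> edges2 (base K)"
    "P = cls p" "R = cls (gsnoc K (gsnoc K p b) a)"
    using edges2_Y_E[OF assms] by blast
  let ?c = "cmp (base K) a b"
  have c: "?c \<in> edges (base K)" "ini (base K) ?c = ini (base K) b"
    using p(2) base.cmp_in base.ini_cmp by auto
  have pc: "p \<in> gpaths_betw K \<sigma>\<^sub>0 (ini (base K) ?c)" using p c by simp
  have R: "R = cls (gsnoc K p ?c)" using eclass_cmp[OF p(1,2)] p(4) by simp
  have "cls (gsnoc K q ?c) = R" if "q \<in> P" for q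
    using that unfolding R p(3)
    by (intro eclass_gsnoc_cong[OF pc eclass_in[OF p(1)] eclass_eqI[OF p(1)] c(1)])
  moreover have "P \<noteq> {}" using eclass_refl[OF p(1)] p(3) by auto
  ultimately show "cmp Y (Q, a, R) (P, b, Q') = (P, ?c, R)"
    by (simp add: universal_complex_def)
  show "(P, ?c, R) \<in> edges Y" using edge_Y[OF pc c(1)] p(3) R by simp
qed (use edges2_Y_E[OF assms] in blast)

lemma scwol_Y: "scwol Y"
proof
  fix E assume "E \<in> edges Y"
  then obtain p a where E: "p \<in> gpaths_betw K \<sigma>\<^sub>0 (ini (base K) a)" "a \<in> edges (base K)"
    "E = (cls p, a, cls (gsnoc K p a))" by (rule edge_Y_E)
  note pa = gsnoc_in[OF E(1,2)]
  show "ini Y E \<in> verts Y" "ter Y E \<in> verts Y" using E pa by auto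
  show "ini Y E \<noteq> ter Y E"
    using eclass_eqD[OF pa E(1)] base.no_loop[OF E(2)] E(3) by auto
next
  fix E F assume EF: "(E, F) \<in> edges2 Y"
  then show "cmp Y E F \<in> edges Y" "ini Y (cmp Y E F) = ini Y F" "ter Y (cmp Y E F) = ter Y E"
    using cmp_Y by (cases E; cases F; simp)+
next
  fix E F G assume EFG: "(E, F, G) \<in> edges3 Y"
  obtain Q a R P b Q' P' c Q'' where eqs: "E = (Q, a, R)" "F = (P, b, Q')" "G = (P', c, Q'')"
    by (cases E; cases F; cases G)
  have EF: "((Q, a, R), (P, b, Q')) \<in> edges2 Y" and FG: "((P, b, Q'), (P', c, Q'')) \<in> edges2 Y"
    using EFG eqs by (auto simp: edges3_def)
  have "((P, cmp (base K) a b, R), (P', c, Q'')) \<in> edges2 Y"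
    "((Q, a, R), (P', cmp (base K) b c, Q')) \<in> edges2 Y"
    using EF FG cmp_Y(2)[OF EF] cmp_Y(2)[OF FG] by (auto simp: edges2_def)
  moreover have "(a, b, c) \<in> edges3 (base K)"
    using cmp_Y(3) EF FG by (simp add: edges3_def)
  ultimately show "cmp Y (cmp Y E F) G = cmp Y E (cmp Y F G)"
    by (simp add: eqs cmp_Y(1) EF FG base.cmp_assoc)
qed

end

section \<open>Lifting paths to the universal complex\<close>

fun lift_oedge :: "'p \<Rightarrow> 'e oedge \<Rightarrow> 'p \<Rightarrow> ('p \<times> 'e \<times> 'p) oedge" where
  "lift_oedge P (Fwd a) Q = Fwd (P, a, Q)"
| "lift_oedge P (Bwd a) Q = Bwd (Q, a, P)"

text \<open>The lift of \<open>q\<close> starting at the vertex of \<open>p\<close> runs through the vertices of \<open>p \<star> r\<close> for the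
  initial segments \<open>r\<close> of \<open>q\<close>.\<close>

fun lift_path :: "('v, 'e, 'g) cog_data \<Rightarrow> 'v \<Rightarrow> ('v, 'e, 'g) gpath \<Rightarrow> ('v, 'e, 'g) gpath \<Rightarrow>
    (('v, 'e, 'g) gpath set \<times> 'e \<times> ('v, 'e, 'g) gpath set) oedge list" where
  "lift_path K \<sigma>\<^sub>0 p (\<tau>, g, []) = []"
| "lift_path K \<sigma>\<^sub>0 p (\<tau>, g, (e, h) # xs) =
    (let p' = gconc K p (\<tau>, g, [(e, \<one>\<^bsub>grp K (oter (base K) e)\<^esub>)])
     in lift_oedge (eclass K \<sigma>\<^sub>0 p) e (eclass K \<sigma>\<^sub>0 p') # lift_path K \<sigma>\<^sub>0 p' (oter (base K) e, h, xs))"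

context pointed_complex_of_groups
begin

interpretation base: scwol "base K"
  by (rule scwol_base)

interpretation Y: scwol Y
  by (rule scwol_Y)

abbreviation lift where "lift \<equiv> lift_path K \<sigma>\<^sub>0"

lemma lift_oedge_in:
  assumes p: "p \<in> gpaths_betw K \<sigma>\<^sub>0 (oini (base K) e)" and e: "oedge_of e \<in> edges (base K)"
    and g: "g \<in> carrier (grp K (oini (base K) e))"
  shows "oedge_of (lift_oedge (cls p) e (cls (p \<star> edge_path g e))) \<in> edges Y"
    and "oini Y (lift_oedge (cls p) e (cls (p \<star> edge_path g e))) = cls p"
    and "oter Y (lift_oedge (cls p) e (cls (p \<star> edge_path g e))) = cls (p \<star> edge_path g e)"
proof -
  show "oedge_of (lift_oedge (cls p) e (cls (p \<star> edge_path g e))) \<in> edges Y"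
  proof (cases e)
    case (Fwd a)
    then have "cls (p \<star> edge_path g e) = cls (gsnoc K p a)"
      using eclass_edge_fwd[of p a g] assms by simp
    then show ?thesis using edge_Y[of p a] assms Fwd by simp
  next
    case (Bwd a)
    let ?q = "p \<star> edge_path g e"
    have "cls (gsnoc K ?q a) = cls p"
      using eclass_edge_bwd[of p a g] assms Bwd by simp
    moreover have "?q \<in> gpaths_betw K \<sigma>\<^sub>0 (ini (base K) a)"
      using gconc_in[OF p edge_path_in[OF e g]] Bwd by simp
    ultimately show ?thesis using edge_Y[of ?q a] e Bwd by simp
  qed
qed (cases e; simp)+

lemma path_decomp:
  assumes p: "p \<in> gpaths_betw K \<sigma> \<tau>" and q: "(\<tau>, g, (e, h) # xs) \<in> gpaths_betw K \<tau> \<rho>"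
  shows "p \<star> edge_path g e \<in> gpaths_betw K \<sigma> (oter (base K) e)"
    and "(oter (base K) e, h, xs) \<in> gpaths_betw K (oter (base K) e) \<rho>"
    and "p \<star> (\<tau>, g, (e, h) # xs) = p \<star> edge_path g e \<star> (oter (base K) e, h, xs)"
proof -
  have e: "oedge_of e \<in> edges (base K)" "\<tau> = oini (base K) e" "g \<in> carrier (grp K \<tau>)"
    using q by auto
  show q': "(oter (base K) e, h, xs) \<in> gpaths_betw K (oter (base K) e) \<rho>" using q by simp
  have s: "edge_path g e \<in> gpaths_betw K \<tau> (oter (base K) e)" using edge_path_in e by simp
  show "p \<star> edge_path g e \<in> gpaths_betw K \<sigma> (oter (base K) e)" using gconc_in[OF p s] .
  have "edge_path g e \<star> (oter (base K) e, h, xs) = (\<tau>, g, (e, h) # xs)"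
  proof (cases xs)
    case Nil
    then show ?thesis using q e oter_in[OF e(1)] by simp
  next
    case (Cons x ys)
    have "h \<in> carrier (grp K (oter (base K) e))" using q' Cons by (cases x) auto
    then show ?thesis using e oter_in[OF e(1)] by simp
  qed
  with gconc_assoc[OF p s q'] show "p \<star> (\<tau>, g, (e, h) # xs) = p \<star> edge_path g e \<star> (oter (base K) e, h, xs)"
    by (simp only:)
qed

lemma lift_Cons:
  assumes "(\<tau>, g, (e, h) # xs) \<in> gpaths_betw K \<tau> \<rho>"
  shows "lift p (\<tau>, g, (e, h) # xs) = lift_oedge (cls p) e (cls (p \<star> edge_path g e)) #
    lift (p \<star> edge_path g e) (oter (base K) e, h, xs)"
  using assms by (simp add: Let_def)

lemma lift_is_path:
  assumes "p \<in> gpaths_betw K \<sigma>\<^sub>0 \<tau>" "q \<in> gpaths_betw K \<tau> \<rho>"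
  shows "is_path Y (cls p) (lift p q) (cls (p \<star> q))"
proof -
  have "is_path Y (cls p) (lift p (\<tau>, g, xs)) (cls (p \<star> (\<tau>, g, xs)))"
    if "p \<in> gpaths_betw K \<sigma>\<^sub>0 \<tau>" "(\<tau>, g, xs) \<in> gpaths_betw K \<tau> \<rho>" for p \<tau> g xs
    using that
  proof (induction xs arbitrary: p \<tau> g)
    case Nil
    then have "cls (p \<star> (\<tau>, g, [])) = cls p" by (intro eclass_end) auto
    then show ?case using Nil.prems(1) vert_Y[OF Nil.prems(1)] by simp
  next
    case (Cons x xs)
    obtain e h where x: "x = (e, h)" by (cases x)
    note q = Cons.prems(2)[unfolded x]
    note dec = path_decomp[OF Cons.prems(1) q]
    have e: "oedge_of e \<in> edges (base K)" "\<tau> = oini (base K) e" "g \<in> carrier (grp K \<tau>)"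
      using q by auto
    note E = lift_oedge_in[OF Cons.prems(1)[unfolded e(2)] e(1) e(3)[unfolded e(2)]]
    show ?case
      unfolding x lift_Cons[OF q] dec(3) is_path.simps E
      using Cons.IH[OF dec(1,2)] E by blast
  qed
  moreover obtain g xs where "q = (\<tau>, g, xs)" using assms(2) by (cases q) (auto dest: gpaths_betwD(2))
  ultimately show ?thesis using assms by blast
qed

lemma lift_cong:
  assumes "p \<simeq> p'" "p \<in> gpaths_betw K \<sigma>\<^sub>0 \<tau>" "q \<in> gpaths_betw K \<tau> \<rho>"
  shows "lift p' q = lift p q"
proof -
  have "lift p' (\<tau>, g, xs) = lift p (\<tau>, g, xs)"
    if "p \<simeq> p'" "p \<in> gpaths_betw K \<sigma>\<^sub>0 \<tau>" "(\<tau>, g, xs) \<in> gpaths_betw K \<tau> \<rho>" for p p' \<tau> g xs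
    using that
  proof (induction xs arbitrary: p p' \<tau> g)
    case (Cons x xs)
    obtain e h where x: "x = (e, h)" by (cases x)
    note q = Cons.prems(3)[unfolded x]
    note dec = path_decomp[OF Cons.prems(2) q]
    have e: "oedge_of e \<in> edges (base K)" "\<tau> = oini (base K) e" "g \<in> carrier (grp K \<tau>)"
      using q by auto
    have s: "edge_path g e \<in> gpaths_betw K \<tau> (oter (base K) e)" using edge_path_in e by simp
    have h: "p \<star> edge_path g e \<simeq> p' \<star> edge_path g e"
      by (rule homotopic_gconc[OF Cons.prems(1) homotopic_refl Cons.prems(2) s])
    show ?case
      unfolding x lift_Cons[OF q] Cons.IH[OF h dec(1,2)] eclass_homotopic[OF dec(1) h]
        eclass_homotopic[OF Cons.prems(2,1)] ..
  qed simp
  moreover obtain g xs where "q = (\<tau>, g, xs)" using assms(2,3) by (cases q) (auto dest: gpaths_betwD(2))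
  ultimately show ?thesis using assms by blast
qed

lemma lift_end:
  assumes "p \<in> gpaths_betw K \<sigma>\<^sub>0 \<tau>" "g \<in> carrier (grp K \<tau>)" "q \<in> gpaths_betw K \<tau> \<rho>"
  shows "lift p ((\<tau>, g, []) \<star> q) = lift (p \<star> (\<tau>, g, [])) q"
proof -
  obtain h xs where q: "q = (\<tau>, h, xs)" using assms(3) by (cases q) (auto dest: gpaths_betwD(2))
  show ?thesis
  proof (cases xs)
    case (Cons x ys)
    obtain e k where x: "x = (e, k)" by (cases x)
    have e: "oedge_of e \<in> edges (base K)" "\<tau> = oini (base K) e" "h \<in> carrier (grp K \<tau>)"
      using assms(3) q Cons x by auto
    have s: "edge_path h e \<in> gpaths_betw K \<tau> (oter (base K) e)" using edge_path_in e by simp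
    have "p \<star> (\<tau>, g, []) \<star> edge_path h e = p \<star> edge_path (g \<otimes>\<^bsub>grp K \<tau>\<^esub> h) e"
      using gconc_assoc[OF assms(1) end_path_in[OF assms(1,2)] s] e by simp
    then show ?thesis
      using eclass_end[OF assms(1,2)] e unfolding q Cons x by (simp add: Let_def)
  qed (simp add: q)
qed

lemma lift_gconc:
  assumes "p \<in> gpaths_betw K \<sigma>\<^sub>0 \<tau>" "q \<in> gpaths_betw K \<tau> \<rho>" "r \<in> gpaths_betw K \<rho> \<upsilon>"
  shows "lift p (q \<star> r) = lift p q @ lift (p \<star> q) r"
proof -
  have "lift p ((\<tau>, g, xs) \<star> r) = lift p (\<tau>, g, xs) @ lift (p \<star> (\<tau>, g, xs)) r"
    if "p \<in> gpaths_betw K \<sigma>\<^sub>0 \<tau>" "(\<tau>, g, xs) \<in> gpaths_betw K \<tau> \<rho>" for p \<tau> g xs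
    using that
  proof (induction xs arbitrary: p \<tau> g)
    case Nil
    then show ?case using lift_end[of p \<tau> g r \<upsilon>] assms(3) by simp
  next
    case (Cons x xs)
    obtain e h where x: "x = (e, h)" by (cases x)
    note q = Cons.prems(2)[unfolded x]
    note dec = path_decomp[OF Cons.prems(1) q]
    have "fst ((oter (base K) e, h, xs) \<star> r) = oter (base K) e" by simp
    then obtain h' zs where qr: "(oter (base K) e, h, xs) \<star> r = (oter (base K) e, h', zs)"
      by (cases "(oter (base K) e, h, xs) \<star> r") auto
    have eq: "(\<tau>, g, (e, h) # xs) \<star> r = (\<tau>, g, (e, h') # zs)" using qr by simp
    have in': "(\<tau>, g, (e, h') # zs) \<in> gpaths_betw K \<tau> \<upsilon>" using gconc_in[OF q assms(3)] eq by simp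
    show ?case
      unfolding x eq lift_Cons[OF in'] lift_Cons[OF q] dec(3) qr[symmetric] Cons.IH[OF dec(1,2)]
      by simp
  qed
  moreover obtain g xs where "q = (\<tau>, g, xs)" using assms(2) by (cases q) (auto dest: gpaths_betwD(2))
  ultimately show ?thesis using assms by blast
qed

lemma lift_gmove:
  assumes p: "p \<in> gpaths_betw K \<sigma>\<^sub>0 \<tau>" and s: "s \<in> gpaths_betw K \<tau> \<rho>" and move: "gmove K s s'"
  shows "path_homotopic Y (cls p) (lift p s) (lift p s')"
proof -
  have s': "s' \<in> gpaths_betw K \<tau> \<rho>"
    using homotopic_in[OF gmove_homotopic[OF move] s] .
  have ends: "cls (p \<star> s') = cls (p \<star> s)"
    by (rule eclass_homotopic[OF gconc_in[OF p s]
        homotopic_gconc[OF homotopic_refl gmove_homotopic[OF move] p s]])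
  have path: "is_path Y (cls p) (lift p s) (cls (p \<star> s))"
    and path': "is_path Y (cls p) (lift p s') (cls (p \<star> s))"
    using lift_is_path[OF p s] lift_is_path[OF p s'] ends by simp_all
  have flip: "path_homotopic Y (cls p) [E, F] []"
    if "is_path Y (cls p) [E, F] (cls p)" "F = oflip E" for E F
    using that Y.path_homotopic_flip[of E] by auto
  from move show ?thesis
  proof cases
    case (slide_fwd a \<sigma> \<upsilon> k g h)
    with path path' have "lift p s = lift p s'" by (simp add: Let_def)
    then show ?thesis by simp
  next
    case (slide_bwd a \<sigma> \<upsilon> g h k)
    with path path' have "lift p s = lift p s'" by (simp add: Let_def)
    then show ?thesis by simp
  next
    case (cancel_fwd a \<sigma> g h k)
    with path path' obtain Q where l: "lift p s = [Fwd (cls p, a, Q), Bwd (cls p, a, Q)]" "lift p s' = []"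
      by (auto simp: Let_def)
    have "cls (p \<star> s) = cls p" using path' l(2) by simp
    then show ?thesis using path unfolding l by (intro flip) simp_all
  next
    case (cancel_bwd b \<sigma> \<upsilon> g h k)
    with path path' obtain Q where l: "lift p s = [Bwd (Q, b, cls p), Fwd (Q, b, cls p)]" "lift p s' = []"
      by (auto simp: Let_def)
    have "cls (p \<star> s) = cls p" using path' l(2) by simp
    then show ?thesis using path unfolding l by (intro flip) simp_all
  next
    case (comp_fwd a b \<sigma> \<upsilon> g k)
    then obtain Q R R' where l: "lift p s = [Fwd (cls p, b, Q), Fwd (Q, a, R)]"
        "lift p s' = [Fwd (cls p, cmp (base K) a b, R')]"
      by (auto simp: Let_def)
    with path path' have "((Q, a, R), (cls p, b, Q)) \<in> edges2 Y" "R' = R" by (auto simp: edges2_def)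
    with Y.path_homotopic_cmp_fwd cmp_Y(1) show ?thesis unfolding l by fastforce
  next
    case (comp_bwd a b \<sigma> \<upsilon> g k)
    then obtain Q R R' where l: "lift p s = [Bwd (Q, a, cls p), Bwd (R, b, Q)]"
        "lift p s' = [Bwd (R', cmp (base K) a b, cls p)]"
      by (auto simp: Let_def)
    with path path' have "((Q, a, cls p), (R, b, Q)) \<in> edges2 Y" "R' = R" by (auto simp: edges2_def)
    with Y.path_homotopic_cmp_bwd cmp_Y(1) show ?thesis unfolding l by fastforce
  qed
qed

lemma lift_homotopic:
  assumes "q \<simeq> q'" and p: "p \<in> gpaths_betw K \<sigma>\<^sub>0 \<tau>" and "q \<in> gpaths_betw K \<tau> \<rho>"
  shows "path_homotopic Y (cls p) (lift p q) (lift p q')"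
  unfolding path_homotopic_def
proof (rule homotopic_map[OF assms(1,3)], fold path_homotopic_def)
  fix y z assume "y \<in> gpaths_betw K \<tau> \<rho>" "gstep K y z"
  then obtain u s s' v \<alpha> \<beta> where move: "gmove K s s'" and u: "u \<in> gpaths_betw K \<tau> \<alpha>"
    and s: "s \<in> gpaths_betw K \<alpha> \<beta>" and s': "s' \<in> gpaths_betw K \<alpha> \<beta>" and v: "v \<in> gpaths_betw K \<beta> \<rho>"
    and yz: "y = u \<star> s \<star> v" "z = u \<star> s' \<star> v"
    by (auto elim: gstepE)
  have pu: "p \<star> u \<in> gpaths_betw K \<sigma>\<^sub>0 \<alpha>" using gconc_in[OF p u] .
  have pus: "p \<star> u \<star> s \<in> gpaths_betw K \<sigma>\<^sub>0 \<beta>" using gconc_in[OF pu s] .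
  have split: "lift p (u \<star> t \<star> v) = lift p u @ lift (p \<star> u) t @ lift (p \<star> u \<star> t) v"
    if t: "t \<in> gpaths_betw K \<alpha> \<beta>" for t
    using lift_gconc[OF p gconc_in[OF u t] v] lift_gconc[OF p u t] gconc_assoc[OF p u t] by simp
  have "p \<star> u \<star> s \<simeq> p \<star> u \<star> s'"
    by (rule homotopic_gconc[OF homotopic_refl gmove_homotopic[OF move] pu s])
  then have tail: "lift (p \<star> u \<star> s') v = lift (p \<star> u \<star> s) v"
    using pus v by (rule lift_cong)
  have mid: "path_homotopic Y (cls (p \<star> u)) (lift (p \<star> u) s) (lift (p \<star> u) s')"
    by (rule lift_gmove[OF pu s move])
  have "path_homotopic Y (cls p) (lift p u @ lift (p \<star> u) s @ lift (p \<star> u \<star> s) v)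
      (lift p u @ lift (p \<star> u) s' @ lift (p \<star> u \<star> s) v)"
    using Y.path_homotopic_append[OF path_homotopic_refl
        Y.path_homotopic_append[OF mid path_homotopic_refl lift_is_path[OF pu s] lift_is_path[OF pus v]]
        lift_is_path[OF p u]
        Y.is_path_append[OF lift_is_path[OF pu s] lift_is_path[OF pus v]]] .
  then show "path_homotopic Y (cls p) (lift p y) (lift p z)"
    unfolding yz split[OF s] split[OF s'] tail .
qed

lemma lift_surj:
  assumes "p \<in> gpaths_betw K \<sigma>\<^sub>0 \<tau>" "is_path Y (cls p) Es V"
  shows "\<exists>\<rho>. \<exists>q\<in>gpaths_betw K \<tau> \<rho>. lift p q = Es"
  using assms
proof (induction Es arbitrary: p \<tau>)
  case Nil
  have "(\<tau>, \<one>\<^bsub>grp K \<tau>\<^esub>, []) \<in> gpaths_betw K \<tau> \<tau>" using gpaths_betw_verts[OF Nil(1)] by simp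
  then show ?case by (intro exI bexI) auto
next
  case (Cons E Es)
  note p = Cons.prems(1)
  have E: "oedge_of E \<in> edges Y" "oini Y E = cls p" and path: "is_path Y (oter Y E) Es V"
    using Cons.prems(2) by auto
  have "\<exists>e g. oedge_of e \<in> edges (base K) \<and> \<tau> = oini (base K) e \<and> g \<in> carrier (grp K \<tau>) \<and>
      E = lift_oedge (cls p) e (cls (p \<star> edge_path g e))"
  proof (cases E)
    case (Fwd A)
    have "A \<in> edges Y" using E(1) Fwd by simp
    then obtain p' a where A: "p' \<in> gpaths_betw K \<sigma>\<^sub>0 (ini (base K) a)" "a \<in> edges (base K)"
      "A = (cls p', a, cls (gsnoc K p' a))" by (rule edge_Y_E)
    have eq: "cls p' = cls p" using A E(2) Fwd by simp
    have \<tau>: "\<tau> = ini (base K) a" by (rule eclass_eqD[OF p A(1) eq]) simp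
    have one: "\<one>\<^bsub>grp K \<tau>\<^esub> \<in> carrier (grp K \<tau>)" using gpaths_betw_verts[OF p] by simp
    have "cls (gsnoc K p' a) = cls (p \<star> edge_path \<one>\<^bsub>grp K \<tau>\<^esub> (Fwd a))"
      using eclass_gsnoc_cong[OF p[unfolded \<tau>] A(1) eq A(2)] \<tau> by (simp add: gsnoc_def)
    then show ?thesis using A one \<tau> eq Fwd
      by (intro exI[of _ "Fwd a"] exI[of _ "\<one>\<^bsub>grp K \<tau>\<^esub>"]) simp
  next
    case (Bwd A)
    have "A \<in> edges Y" using E(1) Bwd by simp
    then obtain p' a where A: "p' \<in> gpaths_betw K \<sigma>\<^sub>0 (ini (base K) a)" "a \<in> edges (base K)"
      "A = (cls p', a, cls (gsnoc K p' a))" by (rule edge_Y_E)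
    let ?\<sigma> = "ini (base K) a"
    let ?s = "edge_path \<one>\<^bsub>grp K ?\<sigma>\<^esub> (Fwd a)"
    have eq: "cls p = cls (gsnoc K p' a)" using A E(2) Bwd by simp
    obtain g where g: "g \<in> carrier (grp K (ter (base K) a))"
      "p \<simeq> gsnoc K p' a \<star> (ter (base K) a, g, [])" and \<tau>: "\<tau> = ter (base K) a"
      using eclass_eqD[OF gsnoc_in[OF A(1,2)] p eq] by blast
    interpret group "grp K \<tau>" using gpaths_betw_verts[OF p] by (intro group_grp) simp
    let ?g' = "inv\<^bsub>grp K \<tau>\<^esub> g"
    let ?t = "edge_path ?g' (Bwd a)"
    have g': "?g' \<in> carrier (grp K \<tau>)" using g(1) unfolding \<tau>[symmetric] by simp
    have inv: "g \<otimes>\<^bsub>grp K \<tau>\<^esub> ?g' = \<one>\<^bsub>grp K \<tau>\<^esub>"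
      using g(1) unfolding \<tau>[symmetric] by (rule r_inv)
    have in': "?s \<in> gpaths_betw K ?\<sigma> \<tau>" "(\<tau>, g, []) \<in> gpaths_betw K \<tau> \<tau>" "?t \<in> gpaths_betw K \<tau> ?\<sigma>"
      using A g g' \<tau> by auto
    have "gmove K (?s \<star> ((\<tau>, g, []) \<star> ?t)) (?\<sigma>, \<one>\<^bsub>grp K ?\<sigma>\<^esub>, [])"
      using gmove.cancel_fwd[OF A(2) refl, of "\<one>\<^bsub>grp K ?\<sigma>\<^esub>" "\<one>\<^bsub>grp K ?\<sigma>\<^esub>" "\<one>\<^bsub>grp K ?\<sigma>\<^esub>"] A(2) g(1)
      by (simp add: \<tau> inv[unfolded \<tau>])
    then have cancel: "?s \<star> ((\<tau>, g, []) \<star> ?t) \<simeq> (?\<sigma>, \<one>\<^bsub>grp K ?\<sigma>\<^esub>, [])" by (rule gmove_homotopic)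
    have snoc: "gsnoc K p' a = p' \<star> ?s" by (simp add: gsnoc_def)
    have "p \<star> ?t \<simeq> p' \<star> ?s \<star> (\<tau>, g, []) \<star> ?t"
      by (rule homotopic_gconc[OF g(2)[folded \<tau>, unfolded snoc] homotopic_refl p in'(3)])
    also have "p' \<star> ?s \<star> (\<tau>, g, []) \<star> ?t = p' \<star> (?s \<star> ((\<tau>, g, []) \<star> ?t))"
      using gconc_assoc[OF gconc_in[OF A(1) in'(1)] in'(2,3)]
        gconc_assoc[OF A(1) in'(1) gconc_in[OF in'(2,3)]] by (simp only:)
    also have "p' \<star> (?s \<star> ((\<tau>, g, []) \<star> ?t)) \<simeq> p' \<star> (?\<sigma>, \<one>\<^bsub>grp K ?\<sigma>\<^esub>, [])"
      by (rule homotopic_gconc[OF homotopic_refl cancel A(1) gconc_in[OF in'(1) gconc_in[OF in'(2,3)]]])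
    also have "p' \<star> (?\<sigma>, \<one>\<^bsub>grp K ?\<sigma>\<^esub>, []) = p'" by (rule gconc_r_one[OF A(1)])
    finally have "cls p' = cls (p \<star> ?t)" by (rule eclass_homotopic[OF gconc_in[OF p in'(3)]])
    then show ?thesis using A g' \<tau> eq Bwd
      by (intro exI[of _ "Bwd a"] exI[of _ ?g']) simp
  qed
  then obtain e g where e: "oedge_of e \<in> edges (base K)" "\<tau> = oini (base K) e" "g \<in> carrier (grp K \<tau>)"
    and E_eq: "E = lift_oedge (cls p) e (cls (p \<star> edge_path g e))" by blast
  have s: "edge_path g e \<in> gpaths_betw K \<tau> (oter (base K) e)" using edge_path_in e by simp
  have "oter Y E = cls (p \<star> edge_path g e)"
    unfolding E_eq using lift_oedge_in(3)[of p e g] p e by simp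
  then obtain \<rho> q where q: "q \<in> gpaths_betw K (oter (base K) e) \<rho>" "lift (p \<star> edge_path g e) q = Es"
    using Cons.IH[OF gconc_in[OF p s]] path by auto
  have "lift p (edge_path g e \<star> q) = E # Es"
    using lift_gconc[OF p s q(1)] q(2) E_eq e(2) by (simp add: Let_def)
  with gconc_in[OF s q(1)] show ?case by blast
qed

lemma connected_Y: "connected_scwol Y"
proof -
  let ?o = "(\<sigma>\<^sub>0, \<one>\<^bsub>grp K \<sigma>\<^sub>0\<^esub>, [])"
  have triv: "?o \<in> gpaths_betw K \<sigma>\<^sub>0 \<sigma>\<^sub>0" using \<sigma>\<^sub>0_in by simp
  have path: "is_path Y (cls ?o) (lift ?o p) (cls p)" if "p \<in> gpaths_betw K \<sigma>\<^sub>0 \<tau>" for p \<tau>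
    using lift_is_path[OF triv that] gconc_l_one[OF that] by simp
  show ?thesis
    unfolding connected_scwol_def
  proof (intro ballI)
    fix P Q assume "P \<in> verts Y" "Q \<in> verts Y"
    then obtain p q where "p \<in> gpaths_betw K \<sigma>\<^sub>0 (gtgt K p)" "P = cls p"
      "q \<in> gpaths_betw K \<sigma>\<^sub>0 (gtgt K q)" "Q = cls q" unfolding verts_Y by blast
    with path have "is_path Y (cls ?o) (lift ?o p) P" "is_path Y (cls ?o) (lift ?o q) Q" by auto
    then show "\<exists>Es. is_path Y P Es Q"
      using Y.is_path_rev Y.is_path_append by blast
  qed
qed

lemma loop_null_homotopic:
  assumes "is_path Y P Es P"
  shows "path_homotopic Y P Es []"
proof -
  let ?o = "(\<sigma>\<^sub>0, \<one>\<^bsub>grp K \<sigma>\<^sub>0\<^esub>, [])"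
  have triv: "?o \<in> gpaths_betw K \<sigma>\<^sub>0 \<sigma>\<^sub>0" using \<sigma>\<^sub>0_in by simp
  obtain \<tau> p where p: "p \<in> gpaths_betw K \<sigma>\<^sub>0 \<tau>" "P = cls p"
    using Y.is_path_in(1)[OF assms] unfolding verts_Y by blast
  obtain \<rho> q where q: "q \<in> gpaths_betw K \<tau> \<rho>" "lift p q = Es"
    using lift_surj[OF p(1)] assms p(2) by blast
  have op: "?o \<star> p = p" by (rule gconc_l_one[OF p(1)])
  have path_p: "is_path Y (cls ?o) (lift ?o p) P" using lift_is_path[OF triv p(1)] op p(2) by simp
  have "is_path Y P Es (cls (p \<star> q))" using lift_is_path[OF p(1) q(1)] q(2) p(2) by simp
  then have "cls (p \<star> q) = cls p" using is_path_unique[OF assms] p(2) by metis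
  then obtain g where g: "g \<in> carrier (grp K \<tau>)" "p \<star> q \<simeq> p \<star> (\<tau>, g, [])"
    using eclass_eqD[OF p(1) gconc_in[OF p(1) q(1)]] by blast
  have "path_homotopic Y (cls ?o) (lift ?o (p \<star> q)) (lift ?o (p \<star> (\<tau>, g, [])))"
    by (rule lift_homotopic[OF g(2) triv gconc_in[OF p(1) q(1)]])
  then have "path_homotopic Y (cls ?o) (lift ?o p @ Es) (lift ?o p @ [])"
    using lift_gconc[OF triv p(1) q(1)] lift_gconc[OF triv p(1) end_path_in[OF p(1) g(1)]] op q(2) by simp
  then show ?thesis
    using Y.path_homotopic_cancel_prefix[OF path_p assms, of "[]" P] Y.is_path_in(1)[OF assms] by simp
qed

end

theorem proposition3p19:
  fixes K :: "('v, 'e, 'g) cog_data" and \<sigma>\<^sub>0 :: 'v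
  assumes "complex_of_groups K"
    and "developable K"
    and "connected_scwol (base K)"
    and "\<sigma>\<^sub>0 \<in> verts (base K)"
  shows "scwol (universal_complex K \<sigma>\<^sub>0) \<and> simply_connected_scwol (universal_complex K \<sigma>\<^sub>0)"
proof -
  interpret pointed_complex_of_groups K \<sigma>\<^sub>0
    using assms by (simp add: pointed_complex_of_groups_def pointed_complex_of_groups_axioms_def)
  interpret Y: scwol Y by (rule scwol_Y)
  show ?thesis
    using scwol_Y Y.simply_connectedI[OF connected_Y loop_null_homotopic] by blast
qed

end
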